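(* Let $E(H,K)\equiv e\to H\xrightarrow{i} G\xrightarrow{\beta} K\to e$ be a center extension of multiplicative Lie algebras. Then there is an exact sequence $$e\to Z^1_{ML(\Gamma)}(K,H)\xrightarrow{\,i\,}\mathrm{Aut}_H(G)\xrightarrow{\Pi}C^L\xrightarrow{\chi}H^2_{ML(\Gamma)}(K,H),$$ where $\chi(\alpha,\eta)=(s_{\alpha,\eta},s'_{\alpha,\eta},\Gamma)B^2_{ML(\Gamma)}(K,H)$, with $s_{\alpha,\eta}(x,y)=f(\eta(x),\eta(y))\,\alpha(f(x,y))^{-1}$ and $s'_{\alpha,\eta}(x,y)=h(\eta(x),\eta(y))\,\alpha(h(x,y))^{-1}$, and $\Pi(\phi)=(\alpha,\eta)$ with $\alpha=\phi|_H$ and $\eta(x)=\beta(\phi(t(x)))$.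
   Context: A multiplicative Lie algebra is a triple $(G,\cdot,\star)$ where $(G,\cdot)$ is a (possibly non-abelian) group with identity $e$ and $\star$ is a binary operation such that for all $x,y,z\in G$, writing ${}^zx=zxz^{-1}$: $x\star x=e$; $x\star(yz)=(x\star y)\cdot{}^y(x\star z)$; $(xy)\star z={}^x(y\star z)\cdot(x\star z)$; $((x\star y)\star{}^yz)((y\star z)\star{}^zx)((z\star x)\star{}^xy)=e$; ${}^z(x\star y)={}^zx\star{}^zy$. Homomorphisms preserve both operations, and $\mathrm{Aut}$ denotes the group of automorphisms of a multiplicative Lie algebra. A center extension $E(H,K)\equiv e\to H\xrightarrow{i} G\xrightarrow{\beta}K\to e$ is a short exact sequence of multiplicative Lie algebras in which $H$ (identified with $i(H)=\ker\beta$) is contained in the group center $Z(G)$ and $a\star b=e$ for all $a,b\in H$. $H$ is an ideal of $G$, so $g\star a\in H$ for $g\in G$, $a\in H$. A transversal is a map $t:K\to G$ with $\beta(t(x))=x$ for all $x\in K$ and $t(e)=e$; fix one. The associated maps are $f(x,y)=t(x)t(y)t(xy)^{-1}\in H$, $h(x,y)=(t(x)\star t(y))\,t(x\star y)^{-1}\in H$ and $\Gamma_x\in\mathrm{End}(H)$, $\Gamma_x(a)=t(x)\star a$, for $x,y\in K$, $a\in H$. $\mathrm{End}(H)$ is a multiplicative Lie algebra with $(u\cdot v)(a)=u(a)v(a)$, $(u\star v)(a)=u(v(a))\,v(u(a^{-1}))$, and $\Gamma:K\to\mathrm{End}(H)$ is a homomorphism. Cohomology. $Z^1_{ML(\Gamma)}(K,H)$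 is the abelian group (pointwise operation) of maps $\nu:K\to H$ with $\nu(xy)=\nu(x)\nu(y)$ and $\nu(x\star y)=\Gamma_x(\nu(y))\Gamma_y(\nu(x)^{-1})$ for all $x,y\in K$. For the fixed $\Gamma$, $Z^2_{ML(\Gamma)}(K,H)$ is the abelian group (under $(f,h,\Gamma)(f',h',\Gamma)=(ff',hh',\Gamma)$) of triples $(f,h,\Gamma)$ (multiplicative center 2-cocycles) with $f,h:K\times K\to H$ such that, writing $c(z,w)=f(z^{-1},zw)^{-1}f(zw,z^{-1})$, for all $x,y,z\in K$: $f(e,x)=f(x,e)=e$; $h(x,x)=h(x,e)=h(e,x)=e$; $f(x,y)f(xy,z)=f(y,z)f(x,yz)$; $c(y,x\star z)\,f(x\star y,{}^y(x\star z))\,h(x,y)h(x,z)=\Gamma_x(f(y,z))\,h(x,yz)$; $c(x,y\star z)\,f({}^x(y\star z),x\star z)\,h(x,z)h(y,z)=\Gamma_z(f(x,y)^{-1})\,h(xy,z)$; $\Gamma_x(c(z,y))\,\Gamma_y(c(z,x)^{-1})\,h({}^zx,{}^zy)=c(z,x\star y)\,h(x,y)$; $\Gamma_{x\star y}(c(y,z))\Gamma_{y\star z}(c(z,x))\Gamma_{z\star x}(c(x,y))\,\Gamma_z(h(x,y)^{-1})\Gamma_x(h(y,z)^{-1})\Gamma_y(h(z,x)^{-1})\,h(x\star y,{}^yz)\,h(y\star z,{}^zx)\,h(z\star x,{}^xy)\,f((x\star y)\star{}^yz,(y\star z)\star{}^zx)\,f(((z\star x)\star{}^xy)^{-1},(z\star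 x)\star{}^xy)=e$. $B^2_{ML(\Gamma)}(K,H)$ is the subgroup of those triples (2-coboundaries) for which there is a map $\lambda:K\to H$ with $\lambda(e)=e$, $f(x,y)=\lambda(x)\lambda(y)\lambda(xy)^{-1}$ and $h(x,y)=\Gamma_x(\lambda(y))\Gamma_y(\lambda(x)^{-1})\lambda(x\star y)^{-1}$ for all $x,y\in K$. $H^2_{ML(\Gamma)}(K,H)=Z^2_{ML(\Gamma)}(K,H)/B^2_{ML(\Gamma)}(K,H)$. Groups and maps. $\mathrm{Aut}_H(G)=\{\phi\in\mathrm{Aut}(G):\phi(H)=H\}$. $C^L=\{(\alpha,\eta)\in\mathrm{Aut}(H)\times\mathrm{Aut}(K):\alpha\Gamma_x\alpha^{-1}=\Gamma_{\eta(x)}\ \forall x\in K\}$ (compatible pairs). The map $i:Z^1_{ML(\Gamma)}(K,H)\to\mathrm{Aut}_H(G)$ sends $\nu$ to the automorphism $\phi_\nu$ with $\phi_\nu(a\,t(x))=a\,\nu(x)\,t(x)$ for $a\in H$, $x\in K$. With $f,h$ the maps associated with $t$, for $(\alpha,\eta)\in C^L$ the maps $s_{\alpha,\eta},s'_{\alpha,\eta}:K\times K\to H$ are $s_{\alpha,\eta}=r_\alpha r_\eta$ and $s'_{\alpha,\eta}=r'_\alpha r'_\eta$, where $r_\alpha(x,y)=f(x,y)\alpha(f(x,y))^{-1}$, $r'_\alpha(x,y)=h(x,y)\alpha(h(x,y))^{-1}$, $r_\eta(x,y)=f(\eta(x),\eta(y))f(x,y)^{-1}$, $r'_\eta(x,y)=h(\eta(x),\eta(y))h(x,y)^{-1}$;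 that is, $s_{\alpha,\eta}(x,y)=f(\eta(x),\eta(y))\alpha(f(x,y))^{-1}$ and $s'_{\alpha,\eta}(x,y)=h(\eta(x),\eta(y))\alpha(h(x,y))^{-1}$. The triple $(s_{\alpha,\eta},s'_{\alpha,\eta},\Gamma)$ is regarded as an element of $Z^2_{ML(\Gamma)}(K,H)$, and its class $\chi(\alpha,\eta)$ as independent of the choice of $t$. The map $\chi$ need not be a homomorphism; exactness at $C^L$ means that $\mathrm{Im}(\Pi)$ is the set of pairs with trivial $\chi$-class.
   Formalization: In general (s,s') is a cocycle for Γ∘η, not for Γ, so χ(α,η) as displayed is undefined; the theorem takes χ(α,η) to be the class in H²_Γ of (s,s',Γ∘η) transported along α⁻¹, and also proves exactness at C^L with the class of (s,s',Γ∘η) in H² for Γ∘η. *)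

theory Defs
  imports "HOL-Algebra.Coset" "HOL-Algebra.Bij"
begin

section \<open>Multiplicative Lie algebras\<close>

record 'a mult_lie = "'a monoid" +
  star :: "['a, 'a] \<Rightarrow> 'a" (infixl \<open>\<star>\<index>\<close> 70)

definition conjg :: "('a, 'm) monoid_scheme \<Rightarrow> 'a \<Rightarrow> 'a \<Rightarrow> 'a" where
  "conjg G z x = z \<otimes>\<^bsub>G\<^esub> x \<otimes>\<^bsub>G\<^esub> inv\<^bsub>G\<^esub> z"

locale mult_lie_algebra = group G for G :: "('a, 'm) mult_lie_scheme" (structure) +
  assumes star_closed:
      "\<lbrakk>x \<in> carrier G; y \<in> carrier G\<rbrakk> \<Longrightarrow> x \<star> y \<in> carrier G"
    and star_self: "x \<in> carrier G \<Longrightarrow> x \<star> x = \<one>"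
    and star_mult_right:
      "\<lbrakk>x \<in> carrier G; y \<in> carrier G; z \<in> carrier G\<rbrakk>
        \<Longrightarrow> x \<star> (y \<otimes> z) = (x \<star> y) \<otimes> conjg G y (x \<star> z)"
    and star_mult_left:
      "\<lbrakk>x \<in> carrier G; y \<in> carrier G; z \<in> carrier G\<rbrakk>
        \<Longrightarrow> (x \<otimes> y) \<star> z = conjg G x (y \<star> z) \<otimes> (x \<star> z)"
    and star_jacobi:
      "\<lbrakk>x \<in> carrier G; y \<in> carrier G; z \<in> carrier G\<rbrakk>
        \<Longrightarrow> ((x \<star> y) \<star> conjg G y z) \<otimes> ((y \<star> z) \<star> conjg G z x)
              \<otimes> ((z \<star> x) \<star> conjg G x y) = \<one>"
    and star_conj:
      "\<lbrakk>x \<in> carrier G; y \<in> carrier G; z \<in> carrier G\<rbrakk>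
        \<Longrightarrow> conjg G z (x \<star> y) = conjg G z x \<star> conjg G z y"

definition mla_hom ::
  "('a, 'm) mult_lie_scheme \<Rightarrow> ('b, 'n) mult_lie_scheme \<Rightarrow> ('a \<Rightarrow> 'b) set" where
  "mla_hom G K = {\<phi> \<in> hom G K.
     \<forall>x \<in> carrier G. \<forall>y \<in> carrier G. \<phi> (x \<star>\<^bsub>G\<^esub> y) = \<phi> x \<star>\<^bsub>K\<^esub> \<phi> y}"

definition mla_auto :: "('a, 'm) mult_lie_scheme \<Rightarrow> ('a \<Rightarrow> 'a) set" where
  "mla_auto G = mla_hom G G \<inter> Bij (carrier G)"

definition mla_AutoGroup :: "('a, 'm) mult_lie_scheme \<Rightarrow> ('a \<Rightarrow> 'a) monoid" where
  "mla_AutoGroup G = BijGroup (carrier G) \<lparr>carrier := mla_auto G\<rparr>"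


section \<open>Center extensions and transversals\<close>

locale center_extension =
  H: mult_lie_algebra H + G: mult_lie_algebra G + K: mult_lie_algebra K
  for H :: "('h, 'l) mult_lie_scheme"
    and G :: "('g, 'm) mult_lie_scheme"
    and K :: "('k, 'n) mult_lie_scheme" +
  fixes i :: "'h \<Rightarrow> 'g" and \<beta> :: "'g \<Rightarrow> 'k"
  assumes i_hom: "i \<in> mla_hom H G"
    and i_inj: "inj_on i (carrier H)"
    and beta_hom: "\<beta> \<in> mla_hom G K"
    and beta_surj: "\<beta> ` carrier G = carrier K"
    and exact: "i ` carrier H = kernel G K \<beta>"
    and central: "\<lbrakk>a \<in> carrier H; g \<in> carrier G\<rbrakk> \<Longrightarrow> i a \<otimes>\<^bsub>G\<^esub> g = g \<otimes>\<^bsub>G\<^esub> i a"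
    and star_trivial:
      "\<lbrakk>a \<in> carrier H; b \<in> carrier H\<rbrakk> \<Longrightarrow> i a \<star>\<^bsub>G\<^esub> i b = \<one>\<^bsub>G\<^esub>"

definition transversal ::
  "('g, 'm) mult_lie_scheme \<Rightarrow> ('k, 'n) mult_lie_scheme \<Rightarrow> ('g \<Rightarrow> 'k) \<Rightarrow> ('k \<Rightarrow> 'g) \<Rightarrow> bool" where
  "transversal G K \<beta> t \<longleftrightarrow>
     (\<forall>x \<in> carrier K. t x \<in> carrier G \<and> \<beta> (t x) = x) \<and> t \<one>\<^bsub>K\<^esub> = \<one>\<^bsub>G\<^esub>"

text \<open>The next three maps take their values in \<open>i(H)\<close>; they are read in \<open>H\<close> along the
  injection \<open>i\<close>.\<close>

definition ext_f where
  "ext_f H G K i t = (\<lambda>(x, y) \<in> carrier K \<times> carrier K.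
     inv_into (carrier H) i (t x \<otimes>\<^bsub>G\<^esub> t y \<otimes>\<^bsub>G\<^esub> inv\<^bsub>G\<^esub> (t (x \<otimes>\<^bsub>K\<^esub> y))))"

definition ext_h where
  "ext_h H G K i t = (\<lambda>(x, y) \<in> carrier K \<times> carrier K.
     inv_into (carrier H) i ((t x \<star>\<^bsub>G\<^esub> t y) \<otimes>\<^bsub>G\<^esub> inv\<^bsub>G\<^esub> (t (x \<star>\<^bsub>K\<^esub> y))))"

definition ext_Gamma where
  "ext_Gamma H G K i t = (\<lambda>x \<in> carrier K. \<lambda>a \<in> carrier H.
     inv_into (carrier H) i (t x \<star>\<^bsub>G\<^esub> i a))"


section \<open>Cohomology\<close>

definition Z1_ML ::
  "('k, 'n) mult_lie_scheme \<Rightarrow> ('h, 'l) mult_lie_scheme \<Rightarrow> ('k \<Rightarrow> 'h \<Rightarrow> 'h) \<Rightarrow> ('k \<Rightarrow> 'h) monoid" where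
  "Z1_ML K H \<Gamma> =
    \<lparr>carrier = {\<nu> \<in> carrier K \<rightarrow>\<^sub>E carrier H. \<forall>x \<in> carrier K. \<forall>y \<in> carrier K.
        \<nu> (x \<otimes>\<^bsub>K\<^esub> y) = \<nu> x \<otimes>\<^bsub>H\<^esub> \<nu> y \<and>
        \<nu> (x \<star>\<^bsub>K\<^esub> y) = \<Gamma> x (\<nu> y) \<otimes>\<^bsub>H\<^esub> \<Gamma> y (inv\<^bsub>H\<^esub> \<nu> x)},
     monoid.mult = (\<lambda>\<nu> \<nu>'. \<lambda>x \<in> carrier K. \<nu> x \<otimes>\<^bsub>H\<^esub> \<nu>' x),
     one = (\<lambda>x \<in> carrier K. \<one>\<^bsub>H\<^esub>)\<rparr>"

text \<open>If \<open>f\<close> is associated with a transversal \<open>t\<close>, then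
  \<open>t(z) t(w) t(z)\<inverse> = cc(z,w) t(z w z\<inverse>)\<close>.\<close>

definition cc where
  "cc K H f z w =
     inv\<^bsub>H\<^esub> (f (inv\<^bsub>K\<^esub> z, z \<otimes>\<^bsub>K\<^esub> w)) \<otimes>\<^bsub>H\<^esub> f (z \<otimes>\<^bsub>K\<^esub> w, inv\<^bsub>K\<^esub> z)"

type_synonym ('k, 'h) ml_triple =
  "('k \<times> 'k \<Rightarrow> 'h) \<times> ('k \<times> 'k \<Rightarrow> 'h) \<times> ('k \<Rightarrow> 'h \<Rightarrow> 'h)"

definition ml_cocycle ::
  "('k, 'n) mult_lie_scheme \<Rightarrow> ('h, 'l) mult_lie_scheme \<Rightarrow> ('k, 'h) ml_triple \<Rightarrow> bool" where
  "ml_cocycle K H = (\<lambda>(f, h, \<Gamma>).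
    f \<in> carrier K \<times> carrier K \<rightarrow>\<^sub>E carrier H \<and>
    h \<in> carrier K \<times> carrier K \<rightarrow>\<^sub>E carrier H \<and>
    (\<forall>x \<in> carrier K.
       f (\<one>\<^bsub>K\<^esub>, x) = \<one>\<^bsub>H\<^esub> \<and> f (x, \<one>\<^bsub>K\<^esub>) = \<one>\<^bsub>H\<^esub> \<and>
       h (x, x) = \<one>\<^bsub>H\<^esub> \<and> h (x, \<one>\<^bsub>K\<^esub>) = \<one>\<^bsub>H\<^esub> \<and> h (\<one>\<^bsub>K\<^esub>, x) = \<one>\<^bsub>H\<^esub>) \<and>
    (\<forall>x \<in> carrier K. \<forall>y \<in> carrier K. \<forall>z \<in> carrier K.
       f (x, y) \<otimes>\<^bsub>H\<^esub> f (x \<otimes>\<^bsub>K\<^esub> y, z) = f (y, z) \<otimes>\<^bsub>H\<^esub> f (x, y \<otimes>\<^bsub>K\<^esub> z) \<and>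

       cc K H f y (x \<star>\<^bsub>K\<^esub> z) \<otimes>\<^bsub>H\<^esub> f (x \<star>\<^bsub>K\<^esub> y, conjg K y (x \<star>\<^bsub>K\<^esub> z))
         \<otimes>\<^bsub>H\<^esub> h (x, y) \<otimes>\<^bsub>H\<^esub> h (x, z)
       = \<Gamma> x (f (y, z)) \<otimes>\<^bsub>H\<^esub> h (x, y \<otimes>\<^bsub>K\<^esub> z) \<and>

       cc K H f x (y \<star>\<^bsub>K\<^esub> z) \<otimes>\<^bsub>H\<^esub> f (conjg K x (y \<star>\<^bsub>K\<^esub> z), x \<star>\<^bsub>K\<^esub> z)
         \<otimes>\<^bsub>H\<^esub> h (x, z) \<otimes>\<^bsub>H\<^esub> h (y, z)
       = \<Gamma> z (inv\<^bsub>H\<^esub> (f (x, y))) \<otimes>\<^bsub>H\<^esub> h (x \<otimes>\<^bsub>K\<^esub> y, z) \<and>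

       \<Gamma> x (cc K H f z y) \<otimes>\<^bsub>H\<^esub> \<Gamma> y (inv\<^bsub>H\<^esub> (cc K H f z x))
         \<otimes>\<^bsub>H\<^esub> h (conjg K z x, conjg K z y)
       = cc K H f z (x \<star>\<^bsub>K\<^esub> y) \<otimes>\<^bsub>H\<^esub> h (x, y) \<and>

       \<Gamma> (x \<star>\<^bsub>K\<^esub> y) (cc K H f y z) \<otimes>\<^bsub>H\<^esub> \<Gamma> (y \<star>\<^bsub>K\<^esub> z) (cc K H f z x)
         \<otimes>\<^bsub>H\<^esub> \<Gamma> (z \<star>\<^bsub>K\<^esub> x) (cc K H f x y)
         \<otimes>\<^bsub>H\<^esub> \<Gamma> z (inv\<^bsub>H\<^esub> (h (x, y))) \<otimes>\<^bsub>H\<^esub> \<Gamma> x (inv\<^bsub>H\<^esub> (h (y, z)))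
         \<otimes>\<^bsub>H\<^esub> \<Gamma> y (inv\<^bsub>H\<^esub> (h (z, x)))
         \<otimes>\<^bsub>H\<^esub> h (x \<star>\<^bsub>K\<^esub> y, conjg K y z) \<otimes>\<^bsub>H\<^esub> h (y \<star>\<^bsub>K\<^esub> z, conjg K z x)
         \<otimes>\<^bsub>H\<^esub> h (z \<star>\<^bsub>K\<^esub> x, conjg K x y)
         \<otimes>\<^bsub>H\<^esub> f ((x \<star>\<^bsub>K\<^esub> y) \<star>\<^bsub>K\<^esub> conjg K y z, (y \<star>\<^bsub>K\<^esub> z) \<star>\<^bsub>K\<^esub> conjg K z x)
         \<otimes>\<^bsub>H\<^esub> f (inv\<^bsub>K\<^esub> ((z \<star>\<^bsub>K\<^esub> x) \<star>\<^bsub>K\<^esub> conjg K x y),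
                 (z \<star>\<^bsub>K\<^esub> x) \<star>\<^bsub>K\<^esub> conjg K x y)
       = \<one>\<^bsub>H\<^esub>))"

definition Z2_ML ::
  "('k, 'n) mult_lie_scheme \<Rightarrow> ('h, 'l) mult_lie_scheme \<Rightarrow> ('k \<Rightarrow> 'h \<Rightarrow> 'h)
     \<Rightarrow> ('k, 'h) ml_triple monoid" where
  "Z2_ML K H \<Gamma> =
    \<lparr>carrier = {(f, h, \<Theta>). \<Theta> = \<Gamma> \<and> ml_cocycle K H (f, h, \<Theta>)},
     monoid.mult = (\<lambda>(f, h, \<Theta>) (f', h', \<Theta>').
       (\<lambda>p \<in> carrier K \<times> carrier K. f p \<otimes>\<^bsub>H\<^esub> f' p,
        \<lambda>p \<in> carrier K \<times> carrier K. h p \<otimes>\<^bsub>H\<^esub> h' p, \<Theta>)),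
     one = (\<lambda>p \<in> carrier K \<times> carrier K. \<one>\<^bsub>H\<^esub>, \<lambda>p \<in> carrier K \<times> carrier K. \<one>\<^bsub>H\<^esub>, \<Gamma>)\<rparr>"

definition B2_ML ::
  "('k, 'n) mult_lie_scheme \<Rightarrow> ('h, 'l) mult_lie_scheme \<Rightarrow> ('k \<Rightarrow> 'h \<Rightarrow> 'h)
     \<Rightarrow> ('k, 'h) ml_triple set" where
  "B2_ML K H \<Gamma> = {(f, h, \<Theta>) \<in> carrier (Z2_ML K H \<Gamma>).
     \<exists>l \<in> carrier K \<rightarrow> carrier H. l \<one>\<^bsub>K\<^esub> = \<one>\<^bsub>H\<^esub> \<and>
       (\<forall>x \<in> carrier K. \<forall>y \<in> carrier K.
          f (x, y) = l x \<otimes>\<^bsub>H\<^esub> l y \<otimes>\<^bsub>H\<^esub> inv\<^bsub>H\<^esub> (l (x \<otimes>\<^bsub>K\<^esub> y)) \<and>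
          h (x, y) = \<Gamma> x (l y) \<otimes>\<^bsub>H\<^esub> \<Gamma> y (inv\<^bsub>H\<^esub> (l x)) \<otimes>\<^bsub>H\<^esub> inv\<^bsub>H\<^esub> (l (x \<star>\<^bsub>K\<^esub> y)))}"

definition H2_ML where
  "H2_ML K H \<Gamma> = Z2_ML K H \<Gamma> Mod B2_ML K H \<Gamma>"

definition H2_class where
  "H2_class K H \<Gamma> T = B2_ML K H \<Gamma> #>\<^bsub>Z2_ML K H \<Gamma>\<^esub> T"


section \<open>The groups and maps of the sequence\<close>

definition Aut_sub ::
  "('h, 'l) mult_lie_scheme \<Rightarrow> ('g, 'm) mult_lie_scheme \<Rightarrow> ('h \<Rightarrow> 'g) \<Rightarrow> ('g \<Rightarrow> 'g) monoid" where
  "Aut_sub H G i = BijGroup (carrier G)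
     \<lparr>carrier := {\<phi> \<in> mla_auto G. \<phi> ` (i ` carrier H) = i ` carrier H}\<rparr>"

definition compatible_pairs ::
  "('h, 'l) mult_lie_scheme \<Rightarrow> ('k, 'n) mult_lie_scheme \<Rightarrow> ('k \<Rightarrow> 'h \<Rightarrow> 'h)
     \<Rightarrow> (('h \<Rightarrow> 'h) \<times> ('k \<Rightarrow> 'k)) monoid" where
  "compatible_pairs H K \<Gamma> = (mla_AutoGroup H \<times>\<times> mla_AutoGroup K)
     \<lparr>carrier := {(\<alpha>, \<eta>). \<alpha> \<in> mla_auto H \<and> \<eta> \<in> mla_auto K \<and>
        (\<forall>x \<in> carrier K. \<forall>a \<in> carrier H.
           \<alpha> (\<Gamma> x (inv_into (carrier H) \<alpha> a)) = \<Gamma> (\<eta> x) a)}\<rparr>"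

text \<open>Each \<open>g\<close> in \<open>G\<close> is \<open>a t(x)\<close> with \<open>x = \<beta>(g)\<close> and \<open>a = g t(x)\<inverse>\<close> in \<open>i(H)\<close>;
  it is sent to \<open>a \<nu>(x) t(x)\<close>.\<close>

definition wells_iota where
  "wells_iota H G K i \<beta> t = (\<lambda>\<nu>. \<lambda>g \<in> carrier G.
     let x = \<beta> g; a = g \<otimes>\<^bsub>G\<^esub> inv\<^bsub>G\<^esub> (t x) in a \<otimes>\<^bsub>G\<^esub> i (\<nu> x) \<otimes>\<^bsub>G\<^esub> t x)"

definition wells_Pi where
  "wells_Pi H K i \<beta> t = (\<lambda>\<phi>.
     (\<lambda>a \<in> carrier H. inv_into (carrier H) i (\<phi> (i a)), \<lambda>x \<in> carrier K. \<beta> (\<phi> (t x))))"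

definition wells_s where
  "wells_s H K f = (\<lambda>(\<alpha>, \<eta>). \<lambda>(x, y) \<in> carrier K \<times> carrier K.
     f (\<eta> x, \<eta> y) \<otimes>\<^bsub>H\<^esub> inv\<^bsub>H\<^esub> (\<alpha> (f (x, y))))"

definition twist where
  "twist K \<Gamma> \<eta> = (\<lambda>x \<in> carrier K. \<Gamma> (\<eta> x))"

text \<open>The maps \<open>s\<close> and \<open>s'\<close> arise from \<open>f\<close> and \<open>h\<close> by the same formula. Both
  \<open>(f \<circ> \<eta>, h \<circ> \<eta>)\<close> and, by compatibility, \<open>(\<alpha> \<circ> f, \<alpha> \<circ> h)\<close> satisfy the cocycle identities
  for the action \<open>\<Gamma> \<circ> \<eta>\<close>, \<open>\<Gamma> (\<eta> x) = \<alpha> \<circ> \<Gamma> x \<circ> \<alpha>\<inverse>\<close>, and hence so does \<open>(s, s')\<close>;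
  for \<open>\<Gamma>\<close> itself these identities may fail if \<open>\<Gamma> \<circ> \<eta> \<noteq> \<Gamma>\<close>.\<close>

definition wells_triple where
  "wells_triple H K \<Gamma> f h p =
     (wells_s H K f p, wells_s H K h p, twist K \<Gamma> (snd p))"

text \<open>Transport of coefficients along \<open>\<alpha>: H \<rightarrow> H\<close>, which intertwines \<open>\<Theta>\<close> and
  \<open>x \<mapsto> \<alpha>\<inverse> \<circ> \<Theta> x \<circ> \<alpha>\<close>. For \<open>\<Theta> = \<Gamma> \<circ> \<eta>\<close> with \<open>(\<alpha>, \<eta>)\<close> compatible the
  resulting action is \<open>\<Gamma>\<close>.\<close>

definition coeff_pullback ::
  "('h, 'l) mult_lie_scheme \<Rightarrow> ('k, 'n) mult_lie_scheme \<Rightarrow> ('h \<Rightarrow> 'h)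
     \<Rightarrow> ('k, 'h) ml_triple \<Rightarrow> ('k, 'h) ml_triple" where
  "coeff_pullback H K \<alpha> = (\<lambda>(f, h, \<Theta>).
     (\<lambda>p \<in> carrier K \<times> carrier K. inv_into (carrier H) \<alpha> (f p),
      \<lambda>p \<in> carrier K \<times> carrier K. inv_into (carrier H) \<alpha> (h p),
      \<lambda>x \<in> carrier K. \<lambda>a \<in> carrier H. inv_into (carrier H) \<alpha> (\<Theta> x (\<alpha> a))))"

text \<open>The class of \<open>(s, s')\<close> in the second cohomology for the fixed action \<open>\<Gamma>\<close>, the
  triple being regarded as a cocycle for \<open>\<Gamma>\<close> by identifying the coefficients along \<open>\<alpha>\<close>.\<close>

definition wells_chi where
  "wells_chi H G K i t = (\<lambda>p.
     let \<Gamma> = ext_Gamma H G K i t in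
     H2_class K H \<Gamma>
       (coeff_pullback H K (fst p)
         (wells_triple H K \<Gamma> (ext_f H G K i t) (ext_h H G K i t) p)))"

end

theory Submission
  imports Defs
begin

text \<open>
  Every element of \<open>G\<close> has a unique normal form \<open>i(a) t(x)\<close> with \<open>a\<close> in \<open>H\<close> and \<open>x\<close> in \<open>K\<close>.
  Products, stars and conjugates of normal forms are again normal forms, whose \<open>H\<close>-components are
  expressed through \<open>f\<close>, \<open>h\<close> and \<open>\<Gamma>\<close> (\<open>nf_mult\<close>, \<open>nf_star\<close>, \<open>nf_conjg\<close>). Comparing \<open>H\<close>-components
  on the two sides of the axioms of \<open>G\<close>, evaluated at values of \<open>t\<close>, gives exactly the cocycle
  identities for \<open>(f, h, \<Gamma>)\<close> (\<open>ext_ml_cocycle\<close>).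

  An automorphism of \<open>G\<close> that stabilises \<open>H\<close>, inducing \<open>\<alpha>\<close> on \<open>H\<close> and \<open>\<eta>\<close> on \<open>K\<close>, must have the form
  \<open>i(a) t(x) \<mapsto> i(\<alpha>(a) m(x)) t(\<eta>(x))\<close> for some map \<open>m\<close> from \<open>K\<close> to \<open>H\<close> (\<open>automorphism_is_lift\<close>).
  Conversely, for a compatible pair \<open>(\<alpha>, \<eta>)\<close> such a formula defines an automorphism if and only if
  \<open>m\<close> satisfies one equation involving \<open>f\<close> and one involving \<open>h\<close>, for all arguments \<open>x\<close> and \<open>y\<close>
  (\<open>lift_mla_hom_iff\<close>, \<open>lift_automorphism\<close>). The exact sequence is a reading of these equations.
  If \<open>\<alpha>\<close> and \<open>\<eta>\<close> are identities, \<open>f\<close> and \<open>h\<close> cancel and the equations say that \<open>m\<close> is a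
  1-cocycle; this identifies the kernel of \<open>\<Pi>\<close> with the image of \<open>\<iota>\<close> (\<open>iota_image\<close>). In general
  they say that \<open>x \<mapsto> m(x)\<inverse>\<close> exhibits \<open>(s, s')\<close> as a coboundary for the action \<open>\<Gamma> \<circ> \<eta>\<close>
  (\<open>cobounds_T_iff\<close>), so that the obstruction to lifting \<open>(\<alpha>, \<eta>)\<close> is the class of \<open>(s, s')\<close>.

  Cocycles and coboundaries are functorial in the coefficients: a homomorphism of abelian groups that
  intertwines two actions transports both (\<open>ml_cocycle_map\<close>, \<open>cobounds_map\<close>). Applied to inversion
  this yields inverses in the groups of cocycles and coboundaries; applied to \<open>\<alpha>\<close>, together with
  reindexing along \<open>\<eta>\<close>, it shows that \<open>(s, s')\<close> is a cocycle for \<open>\<Gamma> \<circ> \<eta>\<close>; and applied to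
  \<open>\<alpha>\<inverse>\<close> and \<open>\<alpha>\<close> it moves the obstruction from \<open>\<Gamma> \<circ> \<eta>\<close> to the fixed action \<open>\<Gamma>\<close> without losing
  information (\<open>cobounds_T0_iff\<close>). Another transversal has the form \<open>x \<mapsto> i(l(x)) t(x)\<close>; it changes
  \<open>(f, h)\<close> by the coboundary of \<open>l\<close>, hence \<open>(s, s')\<close> by the coboundary of
  \<open>x \<mapsto> l(\<eta>(x)) \<alpha>(l(x))\<inverse>\<close>, and the class does not move (\<open>chi_transversal_independent\<close>).
\<close>

section \<open>Multiplicative Lie algebras and their automorphisms\<close>

context mult_lie_algebra
begin

lemma conjg_closed [simp]:
  "\<lbrakk>z \<in> carrier G; x \<in> carrier G\<rbrakk> \<Longrightarrow> conjg G z x \<in> carrier G"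
  by (simp add: conjg_def)

declare star_closed [simp]

lemma conjg_one [simp]: "z \<in> carrier G \<Longrightarrow> conjg G z \<one> = \<one>"
  by (simp add: conjg_def)

lemma conjg_by_one [simp]: "x \<in> carrier G \<Longrightarrow> conjg G \<one> x = x"
  by (simp add: conjg_def)

lemma conjg_commuting:
  assumes "z \<in> carrier G" "x \<in> carrier G" "z \<otimes> x = x \<otimes> z"
  shows "conjg G z x = x"
  using assms by (simp add: conjg_def m_assoc)

lemma conjg_mult:
  assumes "z \<in> carrier G" "x \<in> carrier G" "y \<in> carrier G"
  shows "conjg G z (x \<otimes> y) = conjg G z x \<otimes> conjg G z y"
  using assms by (simp add: conjg_def m_assoc inv_solve_left)

lemma conjg_eq_one_iff:
  assumes "z \<in> carrier G" "x \<in> carrier G"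
  shows "conjg G z x = \<one> \<longleftrightarrow> x = \<one>"
  proof
  assume "conjg G z x = \<one>"
  then have "z \<otimes> x = z \<otimes> \<one>"
    using assms by (simp add: conjg_def inv_solve_right')
  then show "x = \<one>"
    using assms by simp
qed (use assms in simp)

lemma star_one_right [simp]:
  assumes "x \<in> carrier G"
  shows "x \<star> \<one> = \<one>"
proof -
  have "(x \<star> \<one>) \<otimes> (x \<star> \<one>) = x \<star> \<one>"
    using star_mult_right[of x \<one> \<one>] assms by simp
  then show ?thesis using assms by simp
qed

lemma star_one_left [simp]:
  assumes "x \<in> carrier G"
  shows "\<one> \<star> x = \<one>"
proof -
  have "(\<one> \<star> x) \<otimes> (\<one> \<star> x) = \<one> \<star> x"
    using star_mult_left[of \<one> \<one> x] assms by simp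
  then show ?thesis using assms by simp
qed

text \<open>Expand \<open>(x y) \<star> (x y) = \<one>\<close> by both distributive laws.\<close>

lemma inv_star:
  assumes x: "x \<in> carrier G" and y: "y \<in> carrier G"
  shows "inv (x \<star> y) = y \<star> x"
proof -
  have "\<one> = (x \<otimes> y) \<star> (x \<otimes> y)"
    using x y by (simp add: star_self)
  also have "\<dots> = conjg G x ((y \<star> x) \<otimes> (x \<star> y))"
    using x y by (subst star_mult_left) (simp_all add: star_mult_right star_self conjg_mult)
  finally have "(y \<star> x) \<otimes> (x \<star> y) = \<one>"
    using x y conjg_eq_one_iff[of x "(y \<star> x) \<otimes> (x \<star> y)"] by simp
  then show ?thesis
    using x y by (simp add: inv_equality)
qed

end

lemma mult_BijGroup:
  "\<lbrakk>\<phi> \<in> Bij S; \<psi> \<in> Bij S\<rbrakk> \<Longrightarrow> \<phi> \<otimes>\<^bsub>BijGroup S\<^esub> \<psi> = compose S \<phi> \<psi>"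
  by (simp add: BijGroup_def)

context mult_lie_algebra
begin

lemma mla_auto_mem [simp]: "\<lbrakk>\<phi> \<in> mla_auto G; x \<in> carrier G\<rbrakk> \<Longrightarrow> \<phi> x \<in> carrier G"
  by (auto simp: mla_auto_def mla_hom_def hom_def)

lemma mla_auto_inv_into_mem [simp]:
  "\<lbrakk>\<phi> \<in> mla_auto G; x \<in> carrier G\<rbrakk> \<Longrightarrow> inv_into (carrier G) \<phi> x \<in> carrier G"
  by (auto simp: mla_auto_def intro: Bij_inv_into_mem)

lemma mla_auto_inv_into_right [simp]:
  "\<lbrakk>\<phi> \<in> mla_auto G; x \<in> carrier G\<rbrakk> \<Longrightarrow> \<phi> (inv_into (carrier G) \<phi> x) = x"
  by (auto simp: mla_auto_def Bij_def bij_betw_def intro: f_inv_into_f)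

lemma mla_auto_inv_into_left [simp]:
  "\<lbrakk>\<phi> \<in> mla_auto G; x \<in> carrier G\<rbrakk> \<Longrightarrow> inv_into (carrier G) \<phi> (\<phi> x) = x"
  by (auto simp: mla_auto_def Bij_def bij_betw_def intro: inv_into_f_f)

lemma mla_auto_id: "(\<lambda>x \<in> carrier G. x) \<in> mla_auto G"
  using id_in_auto by (simp add: mla_auto_def mla_hom_def auto_def)

lemma mla_auto_compose:
  assumes "\<phi> \<in> mla_auto G" "\<psi> \<in> mla_auto G"
  shows "compose (carrier G) \<phi> \<psi> \<in> mla_auto G"
proof -
  have "\<phi> \<in> auto G" "\<psi> \<in> auto G"
    using assms by (simp_all add: mla_auto_def mla_hom_def auto_def)
  then have "compose (carrier G) \<phi> \<psi> \<in> auto G"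
    using subgroup.m_closed[OF subgroup_auto, of \<phi> \<psi>] by (simp add: mult_BijGroup auto_def)
  moreover have "\<phi> (\<psi> (x \<star> y)) = \<phi> (\<psi> x) \<star> \<phi> (\<psi> y)" if "x \<in> carrier G" "y \<in> carrier G" for x y
    using assms that mla_auto_mem[OF assms(2)] by (simp add: mla_auto_def mla_hom_def)
  ultimately show ?thesis
    by (simp add: mla_auto_def mla_hom_def auto_def compose_eq)
qed

lemma mla_auto_restrict_inv_into:
  assumes "\<phi> \<in> mla_auto G"
  shows "(\<lambda>x \<in> carrier G. inv_into (carrier G) \<phi> x) \<in> mla_auto G"
proof -
  let ?inv = "\<lambda>x \<in> carrier G. inv_into (carrier G) \<phi> x"
  have \<phi>: "\<phi> \<in> hom G G" "\<phi> \<in> Bij (carrier G)"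
      "\<And>x y. \<lbrakk>x \<in> carrier G; y \<in> carrier G\<rbrakk> \<Longrightarrow> \<phi> (x \<star> y) = \<phi> x \<star> \<phi> y"
    using assms by (auto simp: mla_auto_def mla_hom_def)
  have "?inv (x \<star> y) = ?inv x \<star> ?inv y" if "x \<in> carrier G" "y \<in> carrier G" for x y
    using that Bij_inv_into_lemma[of "carrier G" \<phi> "\<lambda>x y. x \<star> y"] \<phi> by simp
  then show ?thesis
    unfolding mla_auto_def mla_hom_def
    using restrict_inv_into_hom[OF \<phi>(1,2)] restrict_inv_into_Bij[OF \<phi>(2)] by blast
qed

end

context
  fixes G :: "('a, 'm) mult_lie_scheme" and K :: "('b, 'n) mult_lie_scheme" and \<phi>
  assumes G: "mult_lie_algebra G" and K: "mult_lie_algebra K" and \<phi>: "\<phi> \<in> mla_hom G K"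
begin

interpretation G: mult_lie_algebra G by (rule G)
interpretation K: mult_lie_algebra K by (rule K)

lemma mla_hom_group_hom: "group_hom G K \<phi>"
  using \<phi> by unfold_locales (simp add: mla_hom_def)

interpretation group_hom G K \<phi> by (rule mla_hom_group_hom)

lemma mla_hom_star:
  "\<lbrakk>x \<in> carrier G; y \<in> carrier G\<rbrakk> \<Longrightarrow> \<phi> (x \<star>\<^bsub>G\<^esub> y) = \<phi> x \<star>\<^bsub>K\<^esub> \<phi> y"
  using \<phi> by (simp add: mla_hom_def)

lemma mla_hom_conjg:
  "\<lbrakk>z \<in> carrier G; x \<in> carrier G\<rbrakk> \<Longrightarrow> \<phi> (conjg G z x) = conjg K (\<phi> z) (\<phi> x)"
  by (simp add: conjg_def)

end

section \<open>Cocycles and change of coefficients\<close>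

lemma (in comm_group) inv_mult_eq_iff:
  assumes "a \<in> carrier G" "b \<in> carrier G" "u \<in> carrier G" "v \<in> carrier G"
  shows "a \<otimes> inv b = inv u \<otimes> v \<longleftrightarrow> u \<otimes> a = b \<otimes> v"
proof -
  have "a \<otimes> inv b = inv u \<otimes> v \<longleftrightarrow> a = inv u \<otimes> v \<otimes> b"
    using assms by (intro inv_solve_right') auto
  also have "inv u \<otimes> v \<otimes> b = inv u \<otimes> (b \<otimes> v)"
    using assms by (simp add: m_ac)
  also have "a = inv u \<otimes> (b \<otimes> v) \<longleftrightarrow> b \<otimes> v = u \<otimes> a"
    using assms by (intro inv_solve_left) auto
  finally show ?thesis by auto
qed

lemma ml_cocycleD:
  assumes "ml_cocycle K H (f, h, \<Gamma>)"
  shows ml_cocycle_f: "f \<in> carrier K \<times> carrier K \<rightarrow>\<^sub>E carrier H"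
    and ml_cocycle_h: "h \<in> carrier K \<times> carrier K \<rightarrow>\<^sub>E carrier H"
    and ml_cocycle_normalized:
      "x \<in> carrier K \<Longrightarrow> f (\<one>\<^bsub>K\<^esub>, x) = \<one>\<^bsub>H\<^esub>" "x \<in> carrier K \<Longrightarrow> f (x, \<one>\<^bsub>K\<^esub>) = \<one>\<^bsub>H\<^esub>"
      "x \<in> carrier K \<Longrightarrow> h (x, x) = \<one>\<^bsub>H\<^esub>"
      "x \<in> carrier K \<Longrightarrow> h (x, \<one>\<^bsub>K\<^esub>) = \<one>\<^bsub>H\<^esub>" "x \<in> carrier K \<Longrightarrow> h (\<one>\<^bsub>K\<^esub>, x) = \<one>\<^bsub>H\<^esub>"
    and ml_cocycle_assoc: "\<lbrakk>x \<in> carrier K; y \<in> carrier K; z \<in> carrier K\<rbrakk> \<Longrightarrow>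
       f (x, y) \<otimes>\<^bsub>H\<^esub> f (x \<otimes>\<^bsub>K\<^esub> y, z) = f (y, z) \<otimes>\<^bsub>H\<^esub> f (x, y \<otimes>\<^bsub>K\<^esub> z)"
    and ml_cocycle_star_right: "\<lbrakk>x \<in> carrier K; y \<in> carrier K; z \<in> carrier K\<rbrakk> \<Longrightarrow>
       cc K H f y (x \<star>\<^bsub>K\<^esub> z) \<otimes>\<^bsub>H\<^esub> f (x \<star>\<^bsub>K\<^esub> y, conjg K y (x \<star>\<^bsub>K\<^esub> z))
         \<otimes>\<^bsub>H\<^esub> h (x, y) \<otimes>\<^bsub>H\<^esub> h (x, z)
       = \<Gamma> x (f (y, z)) \<otimes>\<^bsub>H\<^esub> h (x, y \<otimes>\<^bsub>K\<^esub> z)"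
    and ml_cocycle_star_left: "\<lbrakk>x \<in> carrier K; y \<in> carrier K; z \<in> carrier K\<rbrakk> \<Longrightarrow>
       cc K H f x (y \<star>\<^bsub>K\<^esub> z) \<otimes>\<^bsub>H\<^esub> f (conjg K x (y \<star>\<^bsub>K\<^esub> z), x \<star>\<^bsub>K\<^esub> z)
         \<otimes>\<^bsub>H\<^esub> h (x, z) \<otimes>\<^bsub>H\<^esub> h (y, z)
       = \<Gamma> z (inv\<^bsub>H\<^esub> (f (x, y))) \<otimes>\<^bsub>H\<^esub> h (x \<otimes>\<^bsub>K\<^esub> y, z)"
    and ml_cocycle_conjg: "\<lbrakk>x \<in> carrier K; y \<in> carrier K; z \<in> carrier K\<rbrakk> \<Longrightarrow>
       \<Gamma> x (cc K H f z y) \<otimes>\<^bsub>H\<^esub> \<Gamma> y (inv\<^bsub>H\<^esub> (cc K H f z x))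
         \<otimes>\<^bsub>H\<^esub> h (conjg K z x, conjg K z y)
       = cc K H f z (x \<star>\<^bsub>K\<^esub> y) \<otimes>\<^bsub>H\<^esub> h (x, y)"
    and ml_cocycle_jacobi: "\<lbrakk>x \<in> carrier K; y \<in> carrier K; z \<in> carrier K\<rbrakk> \<Longrightarrow>
       \<Gamma> (x \<star>\<^bsub>K\<^esub> y) (cc K H f y z) \<otimes>\<^bsub>H\<^esub> \<Gamma> (y \<star>\<^bsub>K\<^esub> z) (cc K H f z x)
         \<otimes>\<^bsub>H\<^esub> \<Gamma> (z \<star>\<^bsub>K\<^esub> x) (cc K H f x y)
         \<otimes>\<^bsub>H\<^esub> \<Gamma> z (inv\<^bsub>H\<^esub> (h (x, y))) \<otimes>\<^bsub>H\<^esub> \<Gamma> x (inv\<^bsub>H\<^esub> (h (y, z)))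
         \<otimes>\<^bsub>H\<^esub> \<Gamma> y (inv\<^bsub>H\<^esub> (h (z, x)))
         \<otimes>\<^bsub>H\<^esub> h (x \<star>\<^bsub>K\<^esub> y, conjg K y z) \<otimes>\<^bsub>H\<^esub> h (y \<star>\<^bsub>K\<^esub> z, conjg K z x)
         \<otimes>\<^bsub>H\<^esub> h (z \<star>\<^bsub>K\<^esub> x, conjg K x y)
         \<otimes>\<^bsub>H\<^esub> f ((x \<star>\<^bsub>K\<^esub> y) \<star>\<^bsub>K\<^esub> conjg K y z, (y \<star>\<^bsub>K\<^esub> z) \<star>\<^bsub>K\<^esub> conjg K z x)
         \<otimes>\<^bsub>H\<^esub> f (inv\<^bsub>K\<^esub> ((z \<star>\<^bsub>K\<^esub> x) \<star>\<^bsub>K\<^esub> conjg K x y),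
                 (z \<star>\<^bsub>K\<^esub> x) \<star>\<^bsub>K\<^esub> conjg K x y)
       = \<one>\<^bsub>H\<^esub>"
  using assms unfolding ml_cocycle_def prod.case by blast+

text \<open>The common setting of the actions \<open>\<Gamma>\<close> and \<open>\<Gamma> \<circ> \<eta>\<close> of a center extension, in which the
  groups of cocycles, coboundaries and cohomology classes are defined.\<close>

locale ml_coefficients = H: comm_group H + K: mult_lie_algebra K
  for H :: "('h, 'l) mult_lie_scheme" and K :: "('k, 'n) mult_lie_scheme" +
  fixes \<Gamma> :: "'k \<Rightarrow> 'h \<Rightarrow> 'h"
  assumes Gamma_hom: "x \<in> carrier K \<Longrightarrow> \<Gamma> x \<in> hom H H"
begin

lemma Gamma_group_hom: "x \<in> carrier K \<Longrightarrow> group_hom H H (\<Gamma> x)"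
  by (intro group_hom.intro group_hom_axioms.intro Gamma_hom H.is_group)

lemma Gamma_closed [simp]: "\<lbrakk>x \<in> carrier K; a \<in> carrier H\<rbrakk> \<Longrightarrow> \<Gamma> x a \<in> carrier H"
  using Gamma_hom by (auto simp: hom_def)

lemma Gamma_mult:
  "\<lbrakk>x \<in> carrier K; a \<in> carrier H; b \<in> carrier H\<rbrakk> \<Longrightarrow> \<Gamma> x (a \<otimes>\<^bsub>H\<^esub> b) = \<Gamma> x a \<otimes>\<^bsub>H\<^esub> \<Gamma> x b"
  using Gamma_hom by (auto simp: hom_def)

lemma Gamma_one [simp]: "x \<in> carrier K \<Longrightarrow> \<Gamma> x \<one>\<^bsub>H\<^esub> = \<one>\<^bsub>H\<^esub>"
  by (rule group_hom.hom_one[OF Gamma_group_hom])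

lemma Gamma_inv: "\<lbrakk>x \<in> carrier K; a \<in> carrier H\<rbrakk> \<Longrightarrow> \<Gamma> x (inv\<^bsub>H\<^esub> a) = inv\<^bsub>H\<^esub> (\<Gamma> x a)"
  by (rule group_hom.hom_inv[OF Gamma_group_hom])

lemma cc_closed [simp]:
  assumes "f \<in> carrier K \<times> carrier K \<rightarrow>\<^sub>E carrier H" "z \<in> carrier K" "w \<in> carrier K"
  shows "cc K H f z w \<in> carrier H"
  using assms by (auto simp: cc_def PiE_iff)

text \<open>Each cocycle identity is an equation between products of values of \<open>f\<close> and \<open>h\<close>, their
  inverses and their images under \<open>\<Gamma>\<close>; a homomorphism that intertwines the actions commutes with
  all of these.\<close>

lemma ml_cocycle_map:
  assumes coc: "ml_cocycle K H (f, h, \<Gamma>)"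
    and m: "m \<in> hom H H"
    and int: "\<And>x a. \<lbrakk>x \<in> carrier K; a \<in> carrier H\<rbrakk> \<Longrightarrow> \<Theta> x (m a) = m (\<Gamma> x a)"
  shows "ml_cocycle K H
    (\<lambda>p \<in> carrier K \<times> carrier K. m (f p), \<lambda>p \<in> carrier K \<times> carrier K. m (h p), \<Theta>)"
proof -
  interpret m: group_hom H H m
    using m by unfold_locales
  have f: "f \<in> carrier K \<times> carrier K \<rightarrow>\<^sub>E carrier H"
    and h: "h \<in> carrier K \<times> carrier K \<rightarrow>\<^sub>E carrier H"
    using ml_cocycleD(1,2)[OF coc] by blast+
  have [simp]: "f (x, y) \<in> carrier H" "h (x, y) \<in> carrier H"
    if "x \<in> carrier K" "y \<in> carrier K" for x y
    using f h that by (auto simp: PiE_iff)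
  have cc: "cc K H (\<lambda>p \<in> carrier K \<times> carrier K. m (f p)) z w = m (cc K H f z w)"
    if "z \<in> carrier K" "w \<in> carrier K" for z w
    using that by (simp add: cc_def)
  have ccc [simp]: "cc K H f z w \<in> carrier H" if "z \<in> carrier K" "w \<in> carrier K" for z w
    using that f by simp
  have inv_m: "inv\<^bsub>H\<^esub> (m a) = m (inv\<^bsub>H\<^esub> a)" if "a \<in> carrier H" for a
    using that by simp
  \<comment> \<open>Collecting each side under a single \<open>m\<close> reduces the claim to the identities of \<open>(f, h, \<Gamma>)\<close>.\<close>
  note pull = m.hom_mult[symmetric] inv_m int
  note D = ml_cocycleD[OF coc]
  show ?thesis
    unfolding ml_cocycle_def prod.case
  proof (intro conjI ballI)
    show "(\<lambda>p \<in> carrier K \<times> carrier K. m (f p)) \<in> carrier K \<times> carrier K \<rightarrow>\<^sub>E carrier H"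
      "(\<lambda>p \<in> carrier K \<times> carrier K. m (h p)) \<in> carrier K \<times> carrier K \<rightarrow>\<^sub>E carrier H"
      by auto
  qed (simp_all add: cc pull D(3-) del: m.hom_mult m.hom_inv)
qed

end

section \<open>The first and second cohomology groups\<close>

lemma restrict_eq_PiE:
  "\<lbrakk>f \<in> A \<rightarrow>\<^sub>E B; \<And>p. p \<in> A \<Longrightarrow> g p = f p\<rbrakk> \<Longrightarrow> restrict g A = f"
  by (auto simp: PiE_iff extensional_def restrict_def)

text \<open>The witness \<open>l\<close> of a coboundary is made explicit because the arguments below are about how it
  changes.\<close>

definition cobounds ::
  "('k, 'n) mult_lie_scheme \<Rightarrow> ('h, 'l) mult_lie_scheme \<Rightarrow> ('k \<Rightarrow> 'h) \<Rightarrow> ('k, 'h) ml_triple \<Rightarrow> bool" where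
  "cobounds K H l = (\<lambda>(f, h, \<Gamma>). l \<in> carrier K \<rightarrow> carrier H \<and> l \<one>\<^bsub>K\<^esub> = \<one>\<^bsub>H\<^esub> \<and>
     (\<forall>x \<in> carrier K. \<forall>y \<in> carrier K.
        f (x, y) = l x \<otimes>\<^bsub>H\<^esub> l y \<otimes>\<^bsub>H\<^esub> inv\<^bsub>H\<^esub> (l (x \<otimes>\<^bsub>K\<^esub> y)) \<and>
        h (x, y) = \<Gamma> x (l y) \<otimes>\<^bsub>H\<^esub> \<Gamma> y (inv\<^bsub>H\<^esub> (l x)) \<otimes>\<^bsub>H\<^esub> inv\<^bsub>H\<^esub> (l (x \<star>\<^bsub>K\<^esub> y))))"

lemma B2_ML_iff: "T \<in> B2_ML K H \<Gamma> \<longleftrightarrow> T \<in> carrier (Z2_ML K H \<Gamma>) \<and> (\<exists>l. cobounds K H l T)"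
  by (cases T) (auto simp: B2_ML_def Z2_ML_def cobounds_def Bex_def)

context ml_coefficients
begin

abbreviation KK where "KK \<equiv> carrier K \<times> carrier K"

lemma ml_cocycle_reindex:
  assumes coc: "ml_cocycle K H (f, h, \<Gamma>)"
    and \<eta>: "\<eta> \<in> mla_hom K K"
  shows "ml_cocycle K H
    (\<lambda>(x, y) \<in> KK. f (\<eta> x, \<eta> y), \<lambda>(x, y) \<in> KK. h (\<eta> x, \<eta> y), twist K \<Gamma> \<eta>)"
proof -
  interpret \<eta>: group_hom K K \<eta>
    using mla_hom_group_hom[OF _ _ \<eta>] K.mult_lie_algebra_axioms by blast
  note eta_simps =
    mla_hom_star[OF K.mult_lie_algebra_axioms K.mult_lie_algebra_axioms \<eta>]
    mla_hom_conjg[OF K.mult_lie_algebra_axioms K.mult_lie_algebra_axioms \<eta>]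
  note D = ml_cocycleD[OF coc]
  have [simp]: "f (x, y) \<in> carrier H" "h (x, y) \<in> carrier H"
    if "x \<in> carrier K" "y \<in> carrier K" for x y
    using D(1,2) that by (auto simp: PiE_iff)
  have cc: "cc K H (\<lambda>(x, y) \<in> KK. f (\<eta> x, \<eta> y)) z w = cc K H f (\<eta> z) (\<eta> w)"
    if "z \<in> carrier K" "w \<in> carrier K" for z w
    using that by (simp add: cc_def)
  show ?thesis
    unfolding ml_cocycle_def prod.case
  proof (intro conjI ballI)
    show "(\<lambda>(x, y) \<in> KK. f (\<eta> x, \<eta> y)) \<in> KK \<rightarrow>\<^sub>E carrier H"
      "(\<lambda>(x, y) \<in> KK. h (\<eta> x, \<eta> y)) \<in> KK \<rightarrow>\<^sub>E carrier H"
      by auto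
  qed (simp_all add: cc eta_simps twist_def D(3-))
qed

lemma ml_cocycle_mult:
  assumes coc: "ml_cocycle K H (f, h, \<Gamma>)" and coc': "ml_cocycle K H (f', h', \<Gamma>)"
  shows "ml_cocycle K H
    (\<lambda>p \<in> KK. f p \<otimes>\<^bsub>H\<^esub> f' p, \<lambda>p \<in> KK. h p \<otimes>\<^bsub>H\<^esub> h' p, \<Gamma>)"
proof -
  note D = ml_cocycleD[OF coc] and D' = ml_cocycleD[OF coc']
  have [simp]: "f (x, y) \<in> carrier H" "h (x, y) \<in> carrier H"
    "f' (x, y) \<in> carrier H" "h' (x, y) \<in> carrier H"
    if "x \<in> carrier K" "y \<in> carrier K" for x y
    using D(1,2) D'(1,2) that by (auto simp: PiE_iff)
  have cc: "cc K H (\<lambda>p \<in> KK. f p \<otimes>\<^bsub>H\<^esub> f' p) z w = cc K H f z w \<otimes>\<^bsub>H\<^esub> cc K H f' z w"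
    if "z \<in> carrier K" "w \<in> carrier K" for z w
    using that by (simp add: cc_def H.inv_mult H.m_ac)
  have [simp]: "cc K H f z w \<in> carrier H" "cc K H f' z w \<in> carrier H"
    if "z \<in> carrier K" "w \<in> carrier K" for z w
    using that D(1) D'(1) by simp_all
  \<comment> \<open>Both sides of an identity for the product split, factor by factor, into the identities for the
    two cocycles: \<open>step\<close> interchanges the middle factors along the nesting of the products.\<close>
  have step: "u \<otimes>\<^bsub>H\<^esub> v = (a \<otimes>\<^bsub>H\<^esub> b) \<otimes>\<^bsub>H\<^esub> (a' \<otimes>\<^bsub>H\<^esub> b')"
    if "u = a \<otimes>\<^bsub>H\<^esub> a'" "v = b \<otimes>\<^bsub>H\<^esub> b'"
      "a \<in> carrier H" "a' \<in> carrier H" "b \<in> carrier H" "b' \<in> carrier H" for u v a a' b b'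
    using that by (simp add: H.m_ac)
  have split: "u = v" if "a = b" "a' = b'" "u = a \<otimes>\<^bsub>H\<^esub> a'" "v = b \<otimes>\<^bsub>H\<^esub> b'" for u v a a' b b'
    using that by simp
  note leaf = cc Gamma_mult H.inv_mult
  show ?thesis
    unfolding ml_cocycle_def prod.case
  proof (intro conjI ballI, goal_cases)
    case (8 x y z)
    show ?case
      by (rule split[OF ml_cocycle_assoc[OF coc, of x y z] ml_cocycle_assoc[OF coc', of x y z]]; (intro step)?) (simp_all add: leaf 8)
  next
    case (9 x y z)
    show ?case
      by (rule split[OF ml_cocycle_star_right[OF coc, of x y z] ml_cocycle_star_right[OF coc', of x y z]]; (intro step)?) (simp_all add: leaf 9)
  next
    case (10 x y z)
    show ?case
      by (rule split[OF ml_cocycle_star_left[OF coc, of x y z] ml_cocycle_star_left[OF coc', of x y z]]; (intro step)?) (simp_all add: leaf 10)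
  next
    case (11 x y z)
    show ?case
      by (rule split[OF ml_cocycle_conjg[OF coc, of x y z] ml_cocycle_conjg[OF coc', of x y z]]; (intro step)?) (simp_all add: leaf 11)
  next
    case (12 x y z)
    show ?case
      by (rule split[OF ml_cocycle_jacobi[OF coc, of x y z] ml_cocycle_jacobi[OF coc', of x y z]]; (intro step)?) (simp_all add: leaf 12)
  qed (auto simp: D(3-7) D'(3-7))
qed

lemma Z2_ML_carrier_iff:
  "T \<in> carrier (Z2_ML K H \<Gamma>) \<longleftrightarrow> (\<exists>f h. T = (f, h, \<Gamma>) \<and> ml_cocycle K H (f, h, \<Gamma>))"
  by (cases T) (auto simp: Z2_ML_def)

lemma Z2_ML_mult:
  "(f, h, \<Theta>) \<otimes>\<^bsub>Z2_ML K H \<Gamma>\<^esub> (f', h', \<Theta>') =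
    (\<lambda>p \<in> KK. f p \<otimes>\<^bsub>H\<^esub> f' p, \<lambda>p \<in> KK. h p \<otimes>\<^bsub>H\<^esub> h' p, \<Theta>)"
  by (simp add: Z2_ML_def)

lemma Z2_ML_one: "\<one>\<^bsub>Z2_ML K H \<Gamma>\<^esub> = (\<lambda>p \<in> KK. \<one>\<^bsub>H\<^esub>, \<lambda>p \<in> KK. \<one>\<^bsub>H\<^esub>, \<Gamma>)"
  by (simp add: Z2_ML_def)

lemma one_ml_cocycle: "ml_cocycle K H (\<lambda>p \<in> KK. \<one>\<^bsub>H\<^esub>, \<lambda>p \<in> KK. \<one>\<^bsub>H\<^esub>, \<Gamma>)"
  unfolding ml_cocycle_def prod.case
  by (intro conjI ballI) (auto simp: cc_def)

lemma inv_hom: "(\<lambda>a. inv\<^bsub>H\<^esub> a) \<in> hom H H"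
  by (auto simp: hom_def H.inv_mult)

lemma inv_ml_cocycle:
  "ml_cocycle K H (f, h, \<Gamma>) \<Longrightarrow>
    ml_cocycle K H (\<lambda>p \<in> KK. inv\<^bsub>H\<^esub> f p, \<lambda>p \<in> KK. inv\<^bsub>H\<^esub> h p, \<Gamma>)"
  by (rule ml_cocycle_map) (simp_all add: inv_hom Gamma_inv)

lemma Z2_ML_comm_group: "comm_group (Z2_ML K H \<Gamma>)"
proof (rule comm_groupI)
  fix T T' assume "T \<in> carrier (Z2_ML K H \<Gamma>)" "T' \<in> carrier (Z2_ML K H \<Gamma>)"
  then obtain f h f' h' where T: "T = (f, h, \<Gamma>)" "ml_cocycle K H (f, h, \<Gamma>)"
    and T': "T' = (f', h', \<Gamma>)" "ml_cocycle K H (f', h', \<Gamma>)"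
    by (auto simp: Z2_ML_carrier_iff)
  note fh = T(2)[THEN ml_cocycle_f] T(2)[THEN ml_cocycle_h] T'(2)[THEN ml_cocycle_f]
    T'(2)[THEN ml_cocycle_h]
  show "T \<otimes>\<^bsub>Z2_ML K H \<Gamma>\<^esub> T' \<in> carrier (Z2_ML K H \<Gamma>)"
    using T T' by (simp add: Z2_ML_mult Z2_ML_carrier_iff ml_cocycle_mult)
  show "T \<otimes>\<^bsub>Z2_ML K H \<Gamma>\<^esub> T' = T' \<otimes>\<^bsub>Z2_ML K H \<Gamma>\<^esub> T"
    using T T' fh by (auto simp: Z2_ML_mult PiE_iff H.m_comm intro!: restrict_ext)
  fix T'' assume "T'' \<in> carrier (Z2_ML K H \<Gamma>)"
  then obtain f'' h'' where T'': "T'' = (f'', h'', \<Gamma>)" "ml_cocycle K H (f'', h'', \<Gamma>)"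
    by (auto simp: Z2_ML_carrier_iff)
  note fh'' = T''(2)[THEN ml_cocycle_f] T''(2)[THEN ml_cocycle_h]
  show "T \<otimes>\<^bsub>Z2_ML K H \<Gamma>\<^esub> T' \<otimes>\<^bsub>Z2_ML K H \<Gamma>\<^esub> T'' = T \<otimes>\<^bsub>Z2_ML K H \<Gamma>\<^esub> (T' \<otimes>\<^bsub>Z2_ML K H \<Gamma>\<^esub> T'')"
    using T T' T'' fh fh'' by (auto simp: Z2_ML_mult PiE_iff H.m_assoc intro!: restrict_ext)
next
  show "\<one>\<^bsub>Z2_ML K H \<Gamma>\<^esub> \<in> carrier (Z2_ML K H \<Gamma>)"
    by (simp add: Z2_ML_one Z2_ML_carrier_iff one_ml_cocycle)
next
  fix T assume "T \<in> carrier (Z2_ML K H \<Gamma>)"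
  then obtain f h where T: "T = (f, h, \<Gamma>)" "ml_cocycle K H (f, h, \<Gamma>)"
    by (auto simp: Z2_ML_carrier_iff)
  note fh = T(2)[THEN ml_cocycle_f] T(2)[THEN ml_cocycle_h]
  show "\<one>\<^bsub>Z2_ML K H \<Gamma>\<^esub> \<otimes>\<^bsub>Z2_ML K H \<Gamma>\<^esub> T = T"
    using T(1) PiE_mem[OF fh(1)] PiE_mem[OF fh(2)]
    by (simp add: Z2_ML_mult Z2_ML_one restrict_eq_PiE[OF fh(1)] restrict_eq_PiE[OF fh(2)])
  show "\<exists>T' \<in> carrier (Z2_ML K H \<Gamma>). T' \<otimes>\<^bsub>Z2_ML K H \<Gamma>\<^esub> T = \<one>\<^bsub>Z2_ML K H \<Gamma>\<^esub>"
  proof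
    let ?T' = "(\<lambda>p \<in> KK. inv\<^bsub>H\<^esub> f p, \<lambda>p \<in> KK. inv\<^bsub>H\<^esub> h p, \<Gamma>)"
    show "?T' \<in> carrier (Z2_ML K H \<Gamma>)"
      using inv_ml_cocycle T(2) by (simp add: Z2_ML_carrier_iff)
    show "?T' \<otimes>\<^bsub>Z2_ML K H \<Gamma>\<^esub> T = \<one>\<^bsub>Z2_ML K H \<Gamma>\<^esub>"
      using T fh by (auto simp: Z2_ML_mult Z2_ML_one PiE_iff intro!: restrict_ext)
  qed
qed

sublocale Z2: comm_group "Z2_ML K H \<Gamma>"
  by (rule Z2_ML_comm_group)

lemma Z2_ML_inv:
  assumes "ml_cocycle K H (f, h, \<Gamma>)"
  shows "inv\<^bsub>Z2_ML K H \<Gamma>\<^esub> (f, h, \<Gamma>) = (\<lambda>p \<in> KK. inv\<^bsub>H\<^esub> f p, \<lambda>p \<in> KK. inv\<^bsub>H\<^esub> h p, \<Gamma>)"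
proof (rule Z2.inv_equality)
  show "(\<lambda>p \<in> KK. inv\<^bsub>H\<^esub> f p, \<lambda>p \<in> KK. inv\<^bsub>H\<^esub> h p, \<Gamma>) \<otimes>\<^bsub>Z2_ML K H \<Gamma>\<^esub> (f, h, \<Gamma>) = \<one>\<^bsub>Z2_ML K H \<Gamma>\<^esub>"
    using ml_cocycle_f[OF assms] ml_cocycle_h[OF assms]
    by (auto simp: Z2_ML_mult Z2_ML_one PiE_iff intro!: restrict_ext)
qed (use assms inv_ml_cocycle in \<open>auto simp: Z2_ML_carrier_iff\<close>)

lemma cobounds_map:
  assumes l: "cobounds K H l (f, h, \<Gamma>)"
    and m: "m \<in> hom H H"
    and int: "\<And>x a. \<lbrakk>x \<in> carrier K; a \<in> carrier H\<rbrakk> \<Longrightarrow> \<Theta> x (m a) = m (\<Gamma> x a)"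
  shows "cobounds K H (m \<circ> l)
    (\<lambda>p \<in> KK. m (f p), \<lambda>p \<in> KK. m (h p), \<Theta>)"
proof -
  interpret m: group_hom H H m
    using m by unfold_locales
  have [simp]: "l x \<in> carrier H" if "x \<in> carrier K" for x
    using l that by (auto simp: cobounds_def)
  have inv_m: "inv\<^bsub>H\<^esub> (m a) = m (inv\<^bsub>H\<^esub> a)" if "a \<in> carrier H" for a
    using that by simp
  show ?thesis
    using l
    by (auto simp: cobounds_def m.hom_mult[symmetric] inv_m int simp del: m.hom_mult m.hom_inv)
qed

lemma cobounds_mult:
  assumes l: "cobounds K H l (f, h, \<Gamma>)" and l': "cobounds K H l' (f', h', \<Gamma>)"
  shows "cobounds K H (\<lambda>x. l x \<otimes>\<^bsub>H\<^esub> l' x)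
    (\<lambda>p \<in> KK. f p \<otimes>\<^bsub>H\<^esub> f' p, \<lambda>p \<in> KK. h p \<otimes>\<^bsub>H\<^esub> h' p, \<Gamma>)"
proof -
  have [simp]: "l x \<in> carrier H" "l' x \<in> carrier H" if "x \<in> carrier K" for x
    using l l' that by (auto simp: cobounds_def)
  show ?thesis
    using l l' by (auto simp: cobounds_def Gamma_mult H.inv_mult H.m_ac)
qed

lemma B2_ML_subgroup: "subgroup (B2_ML K H \<Gamma>) (Z2_ML K H \<Gamma>)"
proof (rule Z2.subgroupI)
  show "B2_ML K H \<Gamma> \<subseteq> carrier (Z2_ML K H \<Gamma>)"
    by (auto simp: B2_ML_iff)
  have "cobounds K H (\<lambda>x. \<one>\<^bsub>H\<^esub>) \<one>\<^bsub>Z2_ML K H \<Gamma>\<^esub>"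
    by (simp add: cobounds_def Z2_ML_one)
  then show "B2_ML K H \<Gamma> \<noteq> {}"
    using Z2.one_closed by (metis B2_ML_iff empty_iff)
next
  fix T assume T: "T \<in> B2_ML K H \<Gamma>"
  then obtain f h l where *: "T = (f, h, \<Gamma>)" "ml_cocycle K H (f, h, \<Gamma>)" "cobounds K H l (f, h, \<Gamma>)"
    by (auto simp: B2_ML_iff Z2_ML_carrier_iff)
  have "cobounds K H ((\<lambda>a. inv\<^bsub>H\<^esub> a) \<circ> l) (inv\<^bsub>Z2_ML K H \<Gamma>\<^esub> T)"
    unfolding *(1) Z2_ML_inv[OF *(2)]
    by (rule cobounds_map[OF *(3) inv_hom]) (simp add: Gamma_inv)
  then show "inv\<^bsub>Z2_ML K H \<Gamma>\<^esub> T \<in> B2_ML K H \<Gamma>"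
    using T by (auto simp: B2_ML_iff)
  fix T' assume T': "T' \<in> B2_ML K H \<Gamma>"
  then obtain f' h' l' where **: "T' = (f', h', \<Gamma>)" "cobounds K H l' (f', h', \<Gamma>)"
    by (auto simp: B2_ML_iff Z2_ML_carrier_iff)
  have "cobounds K H (\<lambda>x. l x \<otimes>\<^bsub>H\<^esub> l' x) (T \<otimes>\<^bsub>Z2_ML K H \<Gamma>\<^esub> T')"
    unfolding *(1) **(1) Z2_ML_mult by (rule cobounds_mult[OF *(3) **(2)])
  then show "T \<otimes>\<^bsub>Z2_ML K H \<Gamma>\<^esub> T' \<in> B2_ML K H \<Gamma>"
    using T T' by (auto simp: B2_ML_iff)
qed

lemma H2_class_closed:
  "T \<in> carrier (Z2_ML K H \<Gamma>) \<Longrightarrow> H2_class K H \<Gamma> T \<in> carrier (H2_ML K H \<Gamma>)"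
  unfolding H2_class_def H2_ML_def FactGroup_def
  using Z2.rcosetsI[OF subgroup.subset[OF B2_ML_subgroup]] by simp

lemma H2_class_eq_one_iff:
  assumes "T \<in> carrier (Z2_ML K H \<Gamma>)"
  shows "H2_class K H \<Gamma> T = \<one>\<^bsub>H2_ML K H \<Gamma>\<^esub> \<longleftrightarrow> (\<exists>l. cobounds K H l T)"
proof -
  have "H2_class K H \<Gamma> T = \<one>\<^bsub>H2_ML K H \<Gamma>\<^esub> \<longleftrightarrow> T \<in> B2_ML K H \<Gamma>"
    unfolding H2_class_def H2_ML_def FactGroup_def
    using Z2.coset_join1[OF _ assms B2_ML_subgroup] Z2.coset_join2[OF assms B2_ML_subgroup]
    by auto
  then show ?thesis
    using assms by (simp add: B2_ML_iff)
qed

lemma H2_class_eqI: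
  assumes T: "ml_cocycle K H (f, h, \<Gamma>)" and T': "ml_cocycle K H (f', h', \<Gamma>)"
    and l: "cobounds K H l
      (\<lambda>p \<in> KK. f p \<otimes>\<^bsub>H\<^esub> inv\<^bsub>H\<^esub> f' p, \<lambda>p \<in> KK. h p \<otimes>\<^bsub>H\<^esub> inv\<^bsub>H\<^esub> h' p, \<Gamma>)"
  shows "H2_class K H \<Gamma> (f, h, \<Gamma>) = H2_class K H \<Gamma> (f', h', \<Gamma>)"
proof -
  let ?Z = "Z2_ML K H \<Gamma>" and ?B = "B2_ML K H \<Gamma>"
  let ?T = "(f, h, \<Gamma>)" and ?T' = "(f', h', \<Gamma>)"
  let ?b = "?T \<otimes>\<^bsub>?Z\<^esub> inv\<^bsub>?Z\<^esub> ?T'"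
  have Z: "?T \<in> carrier ?Z" "?T' \<in> carrier ?Z"
    using T T' by (auto simp: Z2_ML_carrier_iff)
  have "?b = (\<lambda>p \<in> KK. f p \<otimes>\<^bsub>H\<^esub> inv\<^bsub>H\<^esub> f' p, \<lambda>p \<in> KK. h p \<otimes>\<^bsub>H\<^esub> inv\<^bsub>H\<^esub> h' p, \<Gamma>)"
    by (auto simp: Z2_ML_inv[OF T'] Z2_ML_mult intro!: restrict_ext)
  moreover have "?b \<in> carrier ?Z"
    using Z by simp
  ultimately have b: "?b \<in> ?B"
    using l by (auto simp: B2_ML_iff)
  have "?B #>\<^bsub>?Z\<^esub> ?T = ?B #>\<^bsub>?Z\<^esub> (?b \<otimes>\<^bsub>?Z\<^esub> ?T')"
    using Z by (simp add: Z2.m_assoc)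
  also have "\<dots> = ?B #>\<^bsub>?Z\<^esub> ?b #>\<^bsub>?Z\<^esub> ?T'"
    using Z subgroup.subset[OF B2_ML_subgroup] by (simp add: Z2.coset_mult_assoc)
  also have "?B #>\<^bsub>?Z\<^esub> ?b = ?B"
    using Z b by (intro Z2.coset_join2 B2_ML_subgroup) auto
  finally show ?thesis
    by (simp add: H2_class_def)
qed

lemma Z1_ML_comm_group: "comm_group (Z1_ML K H \<Gamma>)"
proof (rule comm_groupI)
  fix \<nu> \<nu>' assume \<nu>: "\<nu> \<in> carrier (Z1_ML K H \<Gamma>)" "\<nu>' \<in> carrier (Z1_ML K H \<Gamma>)"
  then have [simp]: "\<nu> x \<in> carrier H" "\<nu>' x \<in> carrier H" if "x \<in> carrier K" for x
    using that by (auto simp: Z1_ML_def)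
  show "\<nu> \<otimes>\<^bsub>Z1_ML K H \<Gamma>\<^esub> \<nu>' \<in> carrier (Z1_ML K H \<Gamma>)"
    using \<nu> by (simp add: Z1_ML_def Gamma_mult H.inv_mult H.m_ac)
  show "\<nu> \<otimes>\<^bsub>Z1_ML K H \<Gamma>\<^esub> \<nu>' = \<nu>' \<otimes>\<^bsub>Z1_ML K H \<Gamma>\<^esub> \<nu>"
    by (auto simp: Z1_ML_def H.m_comm intro!: restrict_ext)
  fix \<nu>'' assume "\<nu>'' \<in> carrier (Z1_ML K H \<Gamma>)"
  then have [simp]: "\<nu>'' x \<in> carrier H" if "x \<in> carrier K" for x
    using that by (auto simp: Z1_ML_def)
  show "\<nu> \<otimes>\<^bsub>Z1_ML K H \<Gamma>\<^esub> \<nu>' \<otimes>\<^bsub>Z1_ML K H \<Gamma>\<^esub> \<nu>'' = \<nu> \<otimes>\<^bsub>Z1_ML K H \<Gamma>\<^esub> (\<nu>' \<otimes>\<^bsub>Z1_ML K H \<Gamma>\<^esub> \<nu>'')"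
    by (auto simp: Z1_ML_def H.m_assoc intro!: restrict_ext)
next
  show "\<one>\<^bsub>Z1_ML K H \<Gamma>\<^esub> \<in> carrier (Z1_ML K H \<Gamma>)"
    by (auto simp: Z1_ML_def)
next
  fix \<nu> assume \<nu>: "\<nu> \<in> carrier (Z1_ML K H \<Gamma>)"
  then have E: "\<nu> \<in> carrier K \<rightarrow>\<^sub>E carrier H"
    by (simp add: Z1_ML_def)
  then have [simp]: "\<nu> x \<in> carrier H" if "x \<in> carrier K" for x
    using that by auto
  show "\<one>\<^bsub>Z1_ML K H \<Gamma>\<^esub> \<otimes>\<^bsub>Z1_ML K H \<Gamma>\<^esub> \<nu> = \<nu>"
    using E by (auto simp: Z1_ML_def intro!: restrict_eq_PiE)
  show "\<exists>\<nu>' \<in> carrier (Z1_ML K H \<Gamma>). \<nu>' \<otimes>\<^bsub>Z1_ML K H \<Gamma>\<^esub> \<nu> = \<one>\<^bsub>Z1_ML K H \<Gamma>\<^esub>"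
    using \<nu>
    by (intro bexI[of _ "\<lambda>x \<in> carrier K. inv\<^bsub>H\<^esub> \<nu> x"])
      (auto simp: Z1_ML_def Gamma_inv H.inv_mult intro!: restrict_ext)
qed

end

section \<open>Normal forms in a center extension\<close>

locale center_extension_transversal = center_extension H G K i \<beta>
  for H :: "('h, 'l) mult_lie_scheme"
    and G :: "('g, 'm) mult_lie_scheme"
    and K :: "('k, 'n) mult_lie_scheme"
    and i :: "'h \<Rightarrow> 'g" and \<beta> :: "'g \<Rightarrow> 'k" +
  fixes t :: "'k \<Rightarrow> 'g"
  assumes t: "transversal G K \<beta> t"
begin

sublocale i: group_hom H G i
  using mla_hom_group_hom[OF H.mult_lie_algebra_axioms G.mult_lie_algebra_axioms i_hom] .

sublocale \<beta>: group_hom G K \<beta>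
  using mla_hom_group_hom[OF G.mult_lie_algebra_axioms K.mult_lie_algebra_axioms beta_hom] .

lemmas beta_star [simp] =
  mla_hom_star[OF G.mult_lie_algebra_axioms K.mult_lie_algebra_axioms beta_hom]

lemma t_closed [simp]: "x \<in> carrier K \<Longrightarrow> t x \<in> carrier G"
  and beta_t [simp]: "x \<in> carrier K \<Longrightarrow> \<beta> (t x) = x"
  and t_one [simp]: "t \<one>\<^bsub>K\<^esub> = \<one>\<^bsub>G\<^esub>"
  using t by (auto simp: transversal_def)

lemma i_eq_iff [simp]: "\<lbrakk>a \<in> carrier H; b \<in> carrier H\<rbrakk> \<Longrightarrow> i a = i b \<longleftrightarrow> a = b"
  using i_inj by (auto simp: inj_on_def)

lemma beta_i [simp]: "a \<in> carrier H \<Longrightarrow> \<beta> (i a) = \<one>\<^bsub>K\<^esub>"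
  using exact by (auto simp: kernel_def)

lemma inv_into_i [simp]: "a \<in> carrier H \<Longrightarrow> inv_into (carrier H) i (i a) = a"
  by (rule inv_into_f_f[OF i_inj])

lemma
  assumes "g \<in> carrier G" "\<beta> g = \<one>\<^bsub>K\<^esub>"
  shows inv_into_i_closed [simp]: "inv_into (carrier H) i g \<in> carrier H"
    and i_inv_into [simp]: "i (inv_into (carrier H) i g) = g"
proof -
  have "g \<in> i ` carrier H"
    using assms exact by (auto simp: kernel_def)
  then show "inv_into (carrier H) i g \<in> carrier H" "i (inv_into (carrier H) i g) = g"
    by (rule inv_into_into, rule f_inv_into_f)
qed

lemma H_comm_group: "comm_group H"
proof (rule H.group_comm_groupI)
  fix a b assume ab: "a \<in> carrier H" "b \<in> carrier H"
  have "i (a \<otimes>\<^bsub>H\<^esub> b) = i (b \<otimes>\<^bsub>H\<^esub> a)"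
    using ab central[of a "i b"] by simp
  then show "a \<otimes>\<^bsub>H\<^esub> b = b \<otimes>\<^bsub>H\<^esub> a"
    using ab by (subst (asm) i_eq_iff) auto
qed

text \<open>The star is trivial on \<open>i ` carrier H\<close>, hence on \<open>H\<close>; so \<open>\<alpha>\<close> below need only be shown to be an
  automorphism of the group \<open>H\<close>.\<close>

lemma H_star:
  assumes "a \<in> carrier H" "b \<in> carrier H"
  shows "a \<star>\<^bsub>H\<^esub> b = \<one>\<^bsub>H\<^esub>"
proof -
  have "i (a \<star>\<^bsub>H\<^esub> b) = i \<one>\<^bsub>H\<^esub>"
    using assms star_trivial
      mla_hom_star[OF H.mult_lie_algebra_axioms G.mult_lie_algebra_axioms i_hom, of a b]
    by simp
  then show ?thesis
    using assms by (subst (asm) i_eq_iff) auto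
qed

abbreviation "f \<equiv> ext_f H G K i t"
abbreviation "h \<equiv> ext_h H G K i t"
abbreviation "\<Gamma> \<equiv> ext_Gamma H G K i t"

text \<open>The normal form of an element of \<open>G\<close>: its components \<open>a\<close> and \<open>x\<close> are coordinates on \<open>G\<close>.\<close>

definition nf :: "'h \<Rightarrow> 'k \<Rightarrow> 'g" where
  "nf a x = i a \<otimes>\<^bsub>G\<^esub> t x"

lemma nf_closed [simp]: "\<lbrakk>a \<in> carrier H; x \<in> carrier K\<rbrakk> \<Longrightarrow> nf a x \<in> carrier G"
  by (simp add: nf_def)

lemma beta_nf [simp]: "\<lbrakk>a \<in> carrier H; x \<in> carrier K\<rbrakk> \<Longrightarrow> \<beta> (nf a x) = x"
  by (simp add: nf_def)

lemma nf_eq_iff: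
  assumes "a \<in> carrier H" "b \<in> carrier H" "x \<in> carrier K" "y \<in> carrier K"
  shows "nf a x = nf b y \<longleftrightarrow> a = b \<and> x = y"
proof
  assume eq: "nf a x = nf b y"
  then have "x = y"
    using assms by (metis beta_nf)
  with eq show "a = b \<and> x = y"
    using assms by (simp add: nf_def)
qed simp

lemma t_eq_nf: "x \<in> carrier K \<Longrightarrow> t x = nf \<one>\<^bsub>H\<^esub> x"
  by (simp add: nf_def)

lemma nf_one_right: "a \<in> carrier H \<Longrightarrow> nf a \<one>\<^bsub>K\<^esub> = i a"
  by (simp add: nf_def)

lemma one_eq_nf: "\<one>\<^bsub>G\<^esub> = nf \<one>\<^bsub>H\<^esub> \<one>\<^bsub>K\<^esub>"
  by (simp add: nf_def)

definition H_part :: "'g \<Rightarrow> 'h" where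
  "H_part g = inv_into (carrier H) i (g \<otimes>\<^bsub>G\<^esub> inv\<^bsub>G\<^esub> (t (\<beta> g)))"

lemma H_part_closed [simp]: "g \<in> carrier G \<Longrightarrow> H_part g \<in> carrier H"
  by (simp add: H_part_def)

lemma nf_H_part: "g \<in> carrier G \<Longrightarrow> nf (H_part g) (\<beta> g) = g"
  by (simp add: nf_def H_part_def G.m_assoc)

lemma H_part_nf [simp]: "\<lbrakk>a \<in> carrier H; x \<in> carrier K\<rbrakk> \<Longrightarrow> H_part (nf a x) = a"
  using nf_H_part[of "nf a x"] by (simp add: nf_eq_iff)

lemma nf_cases:
  assumes "g \<in> carrier G"
  obtains a x where "a \<in> carrier H" "x \<in> carrier K" "g = nf a x"
  using assms nf_H_part[of g] H_part_closed[of g] \<beta>.hom_closed[of g] by metis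

lemma f_closed [simp]: "\<lbrakk>x \<in> carrier K; y \<in> carrier K\<rbrakk> \<Longrightarrow> f (x, y) \<in> carrier H"
  by (simp add: ext_f_def)

lemma h_closed [simp]: "\<lbrakk>x \<in> carrier K; y \<in> carrier K\<rbrakk> \<Longrightarrow> h (x, y) \<in> carrier H"
  by (simp add: ext_h_def)

lemma t_mult:
  "\<lbrakk>x \<in> carrier K; y \<in> carrier K\<rbrakk> \<Longrightarrow> t x \<otimes>\<^bsub>G\<^esub> t y = nf (f (x, y)) (x \<otimes>\<^bsub>K\<^esub> y)"
  by (simp add: nf_def ext_f_def) (simp add: G.m_assoc)

lemma t_star:
  "\<lbrakk>x \<in> carrier K; y \<in> carrier K\<rbrakk> \<Longrightarrow> t x \<star>\<^bsub>G\<^esub> t y = nf (h (x, y)) (x \<star>\<^bsub>K\<^esub> y)"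
  by (simp add: nf_def ext_h_def) (simp add: G.m_assoc)

lemma i_Gamma_t: "\<lbrakk>x \<in> carrier K; a \<in> carrier H\<rbrakk> \<Longrightarrow> i (\<Gamma> x a) = t x \<star>\<^bsub>G\<^esub> i a"
  by (simp add: ext_Gamma_def)

lemma ext_Gamma_closed: "\<lbrakk>x \<in> carrier K; a \<in> carrier H\<rbrakk> \<Longrightarrow> \<Gamma> x a \<in> carrier H"
  by (simp add: ext_Gamma_def)

lemma conjg_i_left: "\<lbrakk>a \<in> carrier H; g \<in> carrier G\<rbrakk> \<Longrightarrow> conjg G (i a) g = g"
  by (simp add: G.conjg_commuting central)

lemma conjg_i_right: "\<lbrakk>a \<in> carrier H; g \<in> carrier G\<rbrakk> \<Longrightarrow> conjg G g (i a) = i a"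
  by (simp add: G.conjg_commuting central)

lemma conjg_i_mult:
  assumes "a \<in> carrier H" "g \<in> carrier G" "u \<in> carrier G"
  shows "conjg G (i a \<otimes>\<^bsub>G\<^esub> g) u = conjg G g u"
proof -
  have "conjg G (i a \<otimes>\<^bsub>G\<^esub> g) u = conjg G (i a) (conjg G g u)"
    using assms by (simp add: conjg_def G.m_assoc G.inv_mult_group)
  then show ?thesis
    using assms by (simp add: conjg_i_left)
qed

text \<open>Elements with the same image in \<open>K\<close> differ by a central factor, which conjugation ignores.\<close>

lemma conjg_cong_beta:
  assumes "g \<in> carrier G" "g' \<in> carrier G" "u \<in> carrier G" "\<beta> g = \<beta> g'"
  shows "conjg G g u = conjg G g' u"
proof -
  obtain a a' x where "a \<in> carrier H" "a' \<in> carrier H" "x \<in> carrier K" "g = nf a x" "g' = nf a' x"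
    using assms by (metis beta_nf nf_cases)
  then show ?thesis
    using assms by (simp add: nf_def conjg_i_mult)
qed

text \<open>The action on \<open>H\<close> by \<open>\<star>\<close> factors through \<open>\<beta>\<close>, since \<open>H\<close> is central and stars trivially with
  itself. In particular \<open>\<Gamma>\<close> depends on no transversal.\<close>

lemma star_i:
  assumes g: "g \<in> carrier G" and a: "a \<in> carrier H"
  shows "g \<star>\<^bsub>G\<^esub> i a = i (\<Gamma> (\<beta> g) a)"
proof -
  obtain b x where b: "b \<in> carrier H" "x \<in> carrier K" "g = nf b x"
    using g by (rule nf_cases)
  then have "g \<star>\<^bsub>G\<^esub> i a = conjg G (i b) (t x \<star>\<^bsub>G\<^esub> i a) \<otimes>\<^bsub>G\<^esub> (i b \<star>\<^bsub>G\<^esub> i a)"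
    using a by (simp add: nf_def G.star_mult_left)
  also have "\<dots> = t x \<star>\<^bsub>G\<^esub> i a"
    using a b by (simp add: star_trivial conjg_i_left)
  finally show ?thesis
    using a b by (simp add: i_Gamma_t)
qed

lemma i_star:
  assumes g: "g \<in> carrier G" and a: "a \<in> carrier H"
  shows "i a \<star>\<^bsub>G\<^esub> g = i (inv\<^bsub>H\<^esub> (\<Gamma> (\<beta> g) a))"
  using assms G.inv_star[of g "i a"] by (simp add: star_i ext_Gamma_closed)

lemma ext_Gamma_hom: "x \<in> carrier K \<Longrightarrow> \<Gamma> x \<in> hom H H"
proof (rule homI)
  fix a b assume x: "x \<in> carrier K" and ab: "a \<in> carrier H" "b \<in> carrier H"
  have "i (\<Gamma> x (a \<otimes>\<^bsub>H\<^esub> b)) = i (\<Gamma> x a \<otimes>\<^bsub>H\<^esub> \<Gamma> x b)"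
    using x ab by (simp add: i_Gamma_t G.star_mult_right conjg_i_left ext_Gamma_closed)
  then show "\<Gamma> x (a \<otimes>\<^bsub>H\<^esub> b) = \<Gamma> x a \<otimes>\<^bsub>H\<^esub> \<Gamma> x b"
    using x ab by (subst (asm) i_eq_iff) (auto simp: ext_Gamma_closed)
qed (simp add: ext_Gamma_closed)

sublocale ml_coefficients H K "ext_Gamma H G K i t"
  using H_comm_group ext_Gamma_hom
  by (intro ml_coefficients.intro ml_coefficients_axioms.intro K.mult_lie_algebra_axioms)

sublocale H: comm_group H
  by (rule H_comm_group)

text \<open>Conjugation preserves \<open>\<star>\<close> and fixes the central elements \<open>i a\<close> and \<open>i (\<Gamma> x a)\<close>.\<close>

lemma Gamma_conjg:
  assumes "x \<in> carrier K" "z \<in> carrier K" "a \<in> carrier H"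
  shows "\<Gamma> (conjg K z x) a = \<Gamma> x a"
proof -
  have "i (\<Gamma> (conjg K z x) a) = conjg G (t z) (t x) \<star>\<^bsub>G\<^esub> conjg G (t z) (i a)"
    using assms
    by (simp add: star_i conjg_i_right
        mla_hom_conjg[OF G.mult_lie_algebra_axioms K.mult_lie_algebra_axioms beta_hom])
  also have "\<dots> = conjg G (t z) (t x \<star>\<^bsub>G\<^esub> i a)"
    using assms by (simp add: G.star_conj)
  also have "\<dots> = i (\<Gamma> x a)"
    using assms by (simp add: star_i conjg_i_right)
  finally show ?thesis
    using assms by (subst (asm) i_eq_iff) auto
qed

lemma nf_mult:
  assumes "a \<in> carrier H" "b \<in> carrier H" "x \<in> carrier K" "y \<in> carrier K"
  shows "nf a x \<otimes>\<^bsub>G\<^esub> nf b y = nf (a \<otimes>\<^bsub>H\<^esub> b \<otimes>\<^bsub>H\<^esub> f (x, y)) (x \<otimes>\<^bsub>K\<^esub> y)"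
proof -
  have "nf a x \<otimes>\<^bsub>G\<^esub> nf b y = i a \<otimes>\<^bsub>G\<^esub> (t x \<otimes>\<^bsub>G\<^esub> i b) \<otimes>\<^bsub>G\<^esub> t y"
    using assms by (simp add: nf_def G.m_assoc)
  also have "\<dots> = i a \<otimes>\<^bsub>G\<^esub> i b \<otimes>\<^bsub>G\<^esub> (t x \<otimes>\<^bsub>G\<^esub> t y)"
    using assms by (simp add: central[of b "t x", symmetric] G.m_assoc)
  also have "\<dots> = nf (a \<otimes>\<^bsub>H\<^esub> b \<otimes>\<^bsub>H\<^esub> f (x, y)) (x \<otimes>\<^bsub>K\<^esub> y)"
    using assms by (simp add: t_mult) (simp add: nf_def G.m_assoc)
  finally show ?thesis .
qed

lemma i_mult_nf:
  "\<lbrakk>a \<in> carrier H; b \<in> carrier H; x \<in> carrier K\<rbrakk> \<Longrightarrow> i a \<otimes>\<^bsub>G\<^esub> nf b x = nf (a \<otimes>\<^bsub>H\<^esub> b) x"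
  by (simp add: nf_def G.m_assoc)

text \<open>By the distributive laws \<open>(i(a) t(x)) \<star> (i(b) t(y))\<close> is the product of \<open>t(x) \<star> i(b)\<close>,
  \<open>t(x) \<star> t(y)\<close> and \<open>i(a) \<star> t(y)\<close>, the remaining factor \<open>i(a) \<star> i(b)\<close> being trivial.\<close>

lemma nf_star:
  assumes [simp]: "a \<in> carrier H" "b \<in> carrier H" "x \<in> carrier K" "y \<in> carrier K"
  shows "nf a x \<star>\<^bsub>G\<^esub> nf b y = nf (\<Gamma> x b \<otimes>\<^bsub>H\<^esub> \<Gamma> y (inv\<^bsub>H\<^esub> a) \<otimes>\<^bsub>H\<^esub> h (x, y)) (x \<star>\<^bsub>K\<^esub> y)"
proof -
  have right: "g \<star>\<^bsub>G\<^esub> nf b y = (g \<star>\<^bsub>G\<^esub> i b) \<otimes>\<^bsub>G\<^esub> (g \<star>\<^bsub>G\<^esub> t y)" if "g \<in> carrier G" for g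
    using that by (simp add: nf_def G.star_mult_right conjg_i_left)
  have "nf a x \<star>\<^bsub>G\<^esub> nf b y = (t x \<star>\<^bsub>G\<^esub> nf b y) \<otimes>\<^bsub>G\<^esub> (i a \<star>\<^bsub>G\<^esub> nf b y)"
    unfolding nf_def[of a x] by (simp add: G.star_mult_left conjg_i_left)
  also have "\<dots> = i (\<Gamma> x b) \<otimes>\<^bsub>G\<^esub> nf (h (x, y)) (x \<star>\<^bsub>K\<^esub> y) \<otimes>\<^bsub>G\<^esub> i (\<Gamma> y (inv\<^bsub>H\<^esub> a))"
    by (simp add: right[of "t x"] t_star i_star star_i Gamma_inv)
  also have "\<dots> = i (\<Gamma> y (inv\<^bsub>H\<^esub> a)) \<otimes>\<^bsub>G\<^esub> (i (\<Gamma> x b) \<otimes>\<^bsub>G\<^esub> nf (h (x, y)) (x \<star>\<^bsub>K\<^esub> y))"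
    by (rule central[symmetric]) auto
  also have "\<dots> = nf (\<Gamma> x b \<otimes>\<^bsub>H\<^esub> \<Gamma> y (inv\<^bsub>H\<^esub> a) \<otimes>\<^bsub>H\<^esub> h (x, y)) (x \<star>\<^bsub>K\<^esub> y)"
    by (simp add: i_mult_nf H.m_ac)
  finally show ?thesis .
qed

lemma nf_conjg:
  assumes [simp]: "a \<in> carrier H" "b \<in> carrier H" "z \<in> carrier K" "w \<in> carrier K"
  shows "conjg G (nf a z) (nf b w) = nf (b \<otimes>\<^bsub>H\<^esub> cc K H f z w) (conjg K z w)"
proof -
  \<comment> \<open>The formula for \<open>cc\<close> comes from conjugating by \<open>t(z\<inverse>)\<inverse>\<close>, which agrees with \<open>t(z)\<close> up to a
    central factor, and from writing \<open>t(w)\<close> as \<open>t(z\<inverse>) t(z w)\<close> up to \<open>f(z\<inverse>, z w)\<close>.\<close>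
  let ?u = "t (inv\<^bsub>K\<^esub> z)" and ?p = "f (inv\<^bsub>K\<^esub> z, z \<otimes>\<^bsub>K\<^esub> w)" and ?q = "f (z \<otimes>\<^bsub>K\<^esub> w, inv\<^bsub>K\<^esub> z)"
  have p: "?u \<otimes>\<^bsub>G\<^esub> t (z \<otimes>\<^bsub>K\<^esub> w) = nf ?p w"
    by (simp add: t_mult flip: K.m_assoc)
  have q: "t (z \<otimes>\<^bsub>K\<^esub> w) \<otimes>\<^bsub>G\<^esub> ?u = nf ?q (conjg K z w)"
    by (simp add: t_mult conjg_def)
  have w: "nf b w = i (b \<otimes>\<^bsub>H\<^esub> inv\<^bsub>H\<^esub> ?p) \<otimes>\<^bsub>G\<^esub> nf ?p w"
    by (subst i_mult_nf) (simp_all add: H.m_assoc)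
  have "conjg G (nf a z) (nf b w) = conjg G (inv\<^bsub>G\<^esub> ?u) (nf b w)"
    by (rule conjg_cong_beta) auto
  also have "\<dots> = conjg G (inv\<^bsub>G\<^esub> ?u) (i (b \<otimes>\<^bsub>H\<^esub> inv\<^bsub>H\<^esub> ?p)) \<otimes>\<^bsub>G\<^esub> conjg G (inv\<^bsub>G\<^esub> ?u) (nf ?p w)"
    unfolding w by (rule G.conjg_mult) auto
  also have "\<dots> = i (b \<otimes>\<^bsub>H\<^esub> inv\<^bsub>H\<^esub> ?p) \<otimes>\<^bsub>G\<^esub> conjg G (inv\<^bsub>G\<^esub> ?u) (?u \<otimes>\<^bsub>G\<^esub> t (z \<otimes>\<^bsub>K\<^esub> w))"
    unfolding p by (subst conjg_i_right) auto
  also have "conjg G (inv\<^bsub>G\<^esub> ?u) (?u \<otimes>\<^bsub>G\<^esub> t (z \<otimes>\<^bsub>K\<^esub> w)) = t (z \<otimes>\<^bsub>K\<^esub> w) \<otimes>\<^bsub>G\<^esub> ?u"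
    by (simp add: conjg_def flip: G.m_assoc)
  also have "i (b \<otimes>\<^bsub>H\<^esub> inv\<^bsub>H\<^esub> ?p) \<otimes>\<^bsub>G\<^esub> (t (z \<otimes>\<^bsub>K\<^esub> w) \<otimes>\<^bsub>G\<^esub> ?u) = nf (b \<otimes>\<^bsub>H\<^esub> cc K H f z w) (conjg K z w)"
    unfolding q by (subst i_mult_nf) (simp_all add: cc_def H.m_assoc)
  finally show ?thesis .
qed

text \<open>Each cocycle identity in three variables is the equality of the \<open>H\<close>-components of the
  two sides of one axiom of \<open>G\<close>, with \<open>t(x)\<close>, \<open>t(y)\<close> and \<open>t(z)\<close> substituted for the variables.\<close>

lemma ext_ml_cocycle: "ml_cocycle K H (f, h, \<Gamma>)"
proof -
  note calc = nf_mult nf_star nf_conjg nf_eq_iff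
  have PiE: "f \<in> KK \<rightarrow>\<^sub>E carrier H" "h \<in> KK \<rightarrow>\<^sub>E carrier H"
    by (auto simp: PiE_iff) (simp_all add: ext_f_def ext_h_def)
  have cc [simp]: "cc K H f z w \<in> carrier H" if "z \<in> carrier K" "w \<in> carrier K" for z w
    using that PiE by simp
  show ?thesis
    unfolding ml_cocycle_def prod.case
  proof (intro conjI ballI, goal_cases)
    case 1 show ?case by (rule PiE)
  next
    case 2 show ?case by (rule PiE)
  next
    case (3 x)
    then show ?case using t_mult[of "\<one>\<^bsub>K\<^esub>" x] by (simp add: t_eq_nf nf_eq_iff)
  next
    case (4 x)
    then show ?case using t_mult[of x "\<one>\<^bsub>K\<^esub>"] by (simp add: t_eq_nf nf_eq_iff)
  next
    case (5 x)
    then show ?case using t_star[of x x] by (simp add: one_eq_nf nf_eq_iff G.star_self K.star_self)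
  next
    case (6 x)
    then have "nf (h (x, \<one>\<^bsub>K\<^esub>)) \<one>\<^bsub>K\<^esub> = nf \<one>\<^bsub>H\<^esub> \<one>\<^bsub>K\<^esub>"
      using t_star[of x "\<one>\<^bsub>K\<^esub>"] by (simp flip: one_eq_nf)
    with 6 show ?case by (simp add: nf_eq_iff)
  next
    case (7 x)
    then have "nf (h (\<one>\<^bsub>K\<^esub>, x)) \<one>\<^bsub>K\<^esub> = nf \<one>\<^bsub>H\<^esub> \<one>\<^bsub>K\<^esub>"
      using t_star[of "\<one>\<^bsub>K\<^esub>" x] by (simp flip: one_eq_nf)
    with 7 show ?case by (simp add: nf_eq_iff)
  next
    case (8 x y z)
    then show ?case
      using G.m_assoc[of "nf \<one>\<^bsub>H\<^esub> x" "nf \<one>\<^bsub>H\<^esub> y" "nf \<one>\<^bsub>H\<^esub> z"] by (simp add: calc)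
  next
    case (9 x y z)
    then show ?case
      using G.star_mult_right[of "nf \<one>\<^bsub>H\<^esub> x" "nf \<one>\<^bsub>H\<^esub> y" "nf \<one>\<^bsub>H\<^esub> z"]
      by (simp add: calc) (simp add: H.m_ac)
  next
    case (10 x y z)
    then show ?case
      using G.star_mult_left[of "nf \<one>\<^bsub>H\<^esub> x" "nf \<one>\<^bsub>H\<^esub> y" "nf \<one>\<^bsub>H\<^esub> z"]
      by (simp add: calc) (simp add: H.m_ac)
  next
    case (11 x y z)
    then show ?case
      using G.star_conj[of "nf \<one>\<^bsub>H\<^esub> x" "nf \<one>\<^bsub>H\<^esub> y" "nf \<one>\<^bsub>H\<^esub> z"]
      by (simp add: calc Gamma_conjg) (simp add: H.m_ac)
  next
    case (12 x y z)
    \<comment> \<open>The last two factors \<open>f\<close> arise from multiplying three normal forms whose \<open>K\<close>-components have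
      product \<open>\<one>\<close>: the first two multiply to the inverse of the third.\<close>
    let ?w = "(z \<star>\<^bsub>K\<^esub> x) \<star>\<^bsub>K\<^esub> conjg K x y"
    have inv_w: "((x \<star>\<^bsub>K\<^esub> y) \<star>\<^bsub>K\<^esub> conjg K y z) \<otimes>\<^bsub>K\<^esub> ((y \<star>\<^bsub>K\<^esub> z) \<star>\<^bsub>K\<^esub> conjg K z x) = inv\<^bsub>K\<^esub> ?w"
      using 12 K.star_jacobi[of x y z] by (intro K.inv_equality[symmetric]) auto
    from 12 show ?case
      using G.star_jacobi[of "nf \<one>\<^bsub>H\<^esub> x" "nf \<one>\<^bsub>H\<^esub> y" "nf \<one>\<^bsub>H\<^esub> z"]
      by (simp add: calc Gamma_conjg inv_w one_eq_nf) (simp add: H.m_ac)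
  qed
qed

section \<open>Lifting pairs of automorphisms\<close>

definition lift :: "('h \<Rightarrow> 'h) \<Rightarrow> ('k \<Rightarrow> 'k) \<Rightarrow> ('k \<Rightarrow> 'h) \<Rightarrow> 'g \<Rightarrow> 'g" where
  "lift \<alpha> \<eta> m = (\<lambda>g \<in> carrier G. nf (\<alpha> (H_part g) \<otimes>\<^bsub>H\<^esub> m (\<beta> g)) (\<eta> (\<beta> g)))"

lemma lift_nf:
  "\<lbrakk>a \<in> carrier H; x \<in> carrier K\<rbrakk> \<Longrightarrow> lift \<alpha> \<eta> m (nf a x) = nf (\<alpha> a \<otimes>\<^bsub>H\<^esub> m x) (\<eta> x)"
  by (simp add: lift_def)

lemma lift_extensional: "lift \<alpha> \<eta> m \<in> extensional (carrier G)"
  by (simp add: lift_def)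

lemma eq_liftI:
  assumes "\<phi> \<in> extensional (carrier G)"
    and "\<And>a x. \<lbrakk>a \<in> carrier H; x \<in> carrier K\<rbrakk> \<Longrightarrow> \<phi> (nf a x) = nf (\<alpha> a \<otimes>\<^bsub>H\<^esub> m x) (\<eta> x)"
  shows "\<phi> = lift \<alpha> \<eta> m"
proof (rule extensionalityI[OF assms(1) lift_extensional])
  fix g assume "g \<in> carrier G"
  then show "\<phi> g = lift \<alpha> \<eta> m g"
    by (rule nf_cases) (simp add: assms(2) lift_nf)
qed

text \<open>The two equations on \<open>m\<close> which say that \<open>lift \<alpha> \<eta> m\<close> preserves products and stars.\<close>

definition lift_condition :: "('h \<Rightarrow> 'h) \<Rightarrow> ('k \<Rightarrow> 'k) \<Rightarrow> ('k \<Rightarrow> 'h) \<Rightarrow> bool" where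
  "lift_condition \<alpha> \<eta> m \<longleftrightarrow> (\<forall>x \<in> carrier K. \<forall>y \<in> carrier K.
     m x \<otimes>\<^bsub>H\<^esub> m y \<otimes>\<^bsub>H\<^esub> f (\<eta> x, \<eta> y) = \<alpha> (f (x, y)) \<otimes>\<^bsub>H\<^esub> m (x \<otimes>\<^bsub>K\<^esub> y) \<and>
     \<Gamma> (\<eta> x) (m y) \<otimes>\<^bsub>H\<^esub> \<Gamma> (\<eta> y) (inv\<^bsub>H\<^esub> (m x)) \<otimes>\<^bsub>H\<^esub> h (\<eta> x, \<eta> y)
       = \<alpha> (h (x, y)) \<otimes>\<^bsub>H\<^esub> m (x \<star>\<^bsub>K\<^esub> y))"

text \<open>For arbitrary normal forms, the \<open>H\<close>-components \<open>a\<close> and \<open>b\<close> contribute the same factor to both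
  sides, by compatibility in the case of \<open>\<star>\<close>; cancelling it leaves a condition on \<open>x\<close> and \<open>y\<close> only.\<close>

lemma lift_mla_hom_iff:
  assumes \<alpha>: "\<alpha> \<in> hom H H" and \<eta>: "\<eta> \<in> mla_hom K K" and m: "m \<in> carrier K \<rightarrow> carrier H"
    and comp: "\<And>x a. \<lbrakk>x \<in> carrier K; a \<in> carrier H\<rbrakk> \<Longrightarrow> \<alpha> (\<Gamma> x a) = \<Gamma> (\<eta> x) (\<alpha> a)"
  shows "lift \<alpha> \<eta> m \<in> mla_hom G G \<longleftrightarrow> lift_condition \<alpha> \<eta> m"
proof -
  interpret \<alpha>: group_hom H H \<alpha>
    using \<alpha> by unfold_locales
  interpret \<eta>: group_hom K K \<eta>
    using mla_hom_group_hom[OF K.mult_lie_algebra_axioms K.mult_lie_algebra_axioms \<eta>] .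
  note eta_star [simp] = mla_hom_star[OF K.mult_lie_algebra_axioms K.mult_lie_algebra_axioms \<eta>]
  have [simp]: "m x \<in> carrier H" if "x \<in> carrier K" for x
    using m that by auto
  have mult_iff: "lift \<alpha> \<eta> m (nf a x \<otimes>\<^bsub>G\<^esub> nf b y) = lift \<alpha> \<eta> m (nf a x) \<otimes>\<^bsub>G\<^esub> lift \<alpha> \<eta> m (nf b y)
      \<longleftrightarrow> m x \<otimes>\<^bsub>H\<^esub> m y \<otimes>\<^bsub>H\<^esub> f (\<eta> x, \<eta> y) = \<alpha> (f (x, y)) \<otimes>\<^bsub>H\<^esub> m (x \<otimes>\<^bsub>K\<^esub> y)"
    (is "_ \<longleftrightarrow> ?l = ?r")
    if [simp]: "a \<in> carrier H" "b \<in> carrier H" "x \<in> carrier K" "y \<in> carrier K" for a b x y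
  proof -
    have "lift \<alpha> \<eta> m (nf a x \<otimes>\<^bsub>G\<^esub> nf b y) = nf (\<alpha> a \<otimes>\<^bsub>H\<^esub> \<alpha> b \<otimes>\<^bsub>H\<^esub> ?r) (\<eta> x \<otimes>\<^bsub>K\<^esub> \<eta> y)"
      by (simp add: nf_mult lift_nf H.m_assoc)
    moreover have "lift \<alpha> \<eta> m (nf a x) \<otimes>\<^bsub>G\<^esub> lift \<alpha> \<eta> m (nf b y)
        = nf (\<alpha> a \<otimes>\<^bsub>H\<^esub> \<alpha> b \<otimes>\<^bsub>H\<^esub> ?l) (\<eta> x \<otimes>\<^bsub>K\<^esub> \<eta> y)"
      by (simp add: nf_mult lift_nf H.m_ac)
    ultimately show ?thesis
      by (auto simp: nf_eq_iff)
  qed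
  have star_iff: "lift \<alpha> \<eta> m (nf a x \<star>\<^bsub>G\<^esub> nf b y) = lift \<alpha> \<eta> m (nf a x) \<star>\<^bsub>G\<^esub> lift \<alpha> \<eta> m (nf b y)
      \<longleftrightarrow> \<Gamma> (\<eta> x) (m y) \<otimes>\<^bsub>H\<^esub> \<Gamma> (\<eta> y) (inv\<^bsub>H\<^esub> (m x)) \<otimes>\<^bsub>H\<^esub> h (\<eta> x, \<eta> y)
        = \<alpha> (h (x, y)) \<otimes>\<^bsub>H\<^esub> m (x \<star>\<^bsub>K\<^esub> y)"
    (is "_ \<longleftrightarrow> ?l = ?r")
    if [simp]: "a \<in> carrier H" "b \<in> carrier H" "x \<in> carrier K" "y \<in> carrier K" for a b x y
  proof -
    let ?c = "\<Gamma> (\<eta> x) (\<alpha> b) \<otimes>\<^bsub>H\<^esub> \<Gamma> (\<eta> y) (inv\<^bsub>H\<^esub> (\<alpha> a))"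
    have "lift \<alpha> \<eta> m (nf a x \<star>\<^bsub>G\<^esub> nf b y) = nf (?c \<otimes>\<^bsub>H\<^esub> ?r) (\<eta> x \<star>\<^bsub>K\<^esub> \<eta> y)"
      by (simp add: nf_star lift_nf comp H.m_assoc)
    moreover have "lift \<alpha> \<eta> m (nf a x) \<star>\<^bsub>G\<^esub> lift \<alpha> \<eta> m (nf b y)
        = nf (?c \<otimes>\<^bsub>H\<^esub> ?l) (\<eta> x \<star>\<^bsub>K\<^esub> \<eta> y)"
      by (simp add: nf_star lift_nf Gamma_mult H.inv_mult H.m_ac)
    ultimately show ?thesis
      by (auto simp: nf_eq_iff)
  qed
  show ?thesis
  proof
    assume L: "lift \<alpha> \<eta> m \<in> mla_hom G G"
    show "lift_condition \<alpha> \<eta> m"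
      unfolding lift_condition_def
    proof (intro ballI conjI)
      fix x y assume [simp]: "x \<in> carrier K" "y \<in> carrier K"
      show "m x \<otimes>\<^bsub>H\<^esub> m y \<otimes>\<^bsub>H\<^esub> f (\<eta> x, \<eta> y) = \<alpha> (f (x, y)) \<otimes>\<^bsub>H\<^esub> m (x \<otimes>\<^bsub>K\<^esub> y)"
        using L by (intro mult_iff[THEN iffD1, of "\<one>\<^bsub>H\<^esub>" "\<one>\<^bsub>H\<^esub>"]) (auto simp: mla_hom_def hom_mult)
      show "\<Gamma> (\<eta> x) (m y) \<otimes>\<^bsub>H\<^esub> \<Gamma> (\<eta> y) (inv\<^bsub>H\<^esub> (m x)) \<otimes>\<^bsub>H\<^esub> h (\<eta> x, \<eta> y)
        = \<alpha> (h (x, y)) \<otimes>\<^bsub>H\<^esub> m (x \<star>\<^bsub>K\<^esub> y)"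
        using L by (intro star_iff[THEN iffD1, of "\<one>\<^bsub>H\<^esub>" "\<one>\<^bsub>H\<^esub>"]) (auto simp: mla_hom_def)
    qed
  next
    assume C: "lift_condition \<alpha> \<eta> m"
    show "lift \<alpha> \<eta> m \<in> mla_hom G G"
      unfolding mla_hom_def mem_Collect_eq
    proof (intro conjI ballI homI)
      fix g g' assume g: "g \<in> carrier G" "g' \<in> carrier G"
      obtain a x b y where *: "a \<in> carrier H" "x \<in> carrier K" "g = nf a x"
          "b \<in> carrier H" "y \<in> carrier K" "g' = nf b y"
        using g by (metis nf_cases)
      show "lift \<alpha> \<eta> m (g \<otimes>\<^bsub>G\<^esub> g') = lift \<alpha> \<eta> m g \<otimes>\<^bsub>G\<^esub> lift \<alpha> \<eta> m g'"
        using C * mult_iff[of a b x y] by (simp add: lift_condition_def)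
      show "lift \<alpha> \<eta> m (g \<star>\<^bsub>G\<^esub> g') = lift \<alpha> \<eta> m g \<star>\<^bsub>G\<^esub> lift \<alpha> \<eta> m g'"
        using C * star_iff[of a b x y] by (simp add: lift_condition_def)
    next
      fix g assume "g \<in> carrier G"
      then show "lift \<alpha> \<eta> m g \<in> carrier G"
        by (simp add: lift_def)
    qed
  qed
qed

section \<open>The groups of automorphisms and of compatible pairs\<close>

abbreviation "A \<equiv> Aut_sub H G i"
abbreviation "C \<equiv> compatible_pairs H K \<Gamma>"
abbreviation "Pi_map \<equiv> wells_Pi H K i \<beta> t"
abbreviation "iota \<equiv> wells_iota H G K i \<beta> t"

lemma A_carrier_iff: "\<phi> \<in> carrier A \<longleftrightarrow> \<phi> \<in> mla_auto G \<and> \<phi> ` i ` carrier H = i ` carrier H"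
  by (simp add: Aut_sub_def)

lemma A_mult: "\<lbrakk>\<phi> \<in> carrier A; \<psi> \<in> carrier A\<rbrakk> \<Longrightarrow> \<phi> \<otimes>\<^bsub>A\<^esub> \<psi> = compose (carrier G) \<phi> \<psi>"
  by (simp add: Aut_sub_def mla_auto_def mult_BijGroup)

lemma A_group: "group A"
proof -
  let ?B = "BijGroup (carrier G)"
  interpret B: group ?B by (rule group_BijGroup)
  have sub: "i ` carrier H \<subseteq> carrier G" by auto
  have "subgroup (carrier A) ?B"
  proof (rule B.subgroupI)
    show "carrier A \<subseteq> carrier ?B"
      by (auto simp: Aut_sub_def mla_auto_def BijGroup_def)
    have "(\<lambda>x \<in> carrier G. x) \<in> carrier A"
      using G.mla_auto_id by (auto simp: A_carrier_iff image_image)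
    then show "carrier A \<noteq> {}" by blast
  next
    fix \<phi> assume \<phi>: "\<phi> \<in> carrier A"
    then have \<phi>': "\<phi> \<in> mla_auto G" "\<phi> \<in> Bij (carrier G)"
      by (auto simp: A_carrier_iff mla_auto_def)
    have "(\<lambda>x \<in> carrier G. inv_into (carrier G) \<phi> x) ` i ` carrier H = inv_into (carrier G) \<phi> ` i ` carrier H"
      using sub by (intro image_cong) auto
    also have "\<dots> = inv_into (carrier G) \<phi> ` \<phi> ` i ` carrier H"
      using \<phi> by (simp add: A_carrier_iff)
    also have "\<dots> = i ` carrier H"
      using \<phi>' by (force simp: image_image)
    finally show "inv\<^bsub>?B\<^esub> \<phi> \<in> carrier A"
      using G.mla_auto_restrict_inv_into[OF \<phi>'(1)] by (simp add: inv_BijGroup[OF \<phi>'(2)] A_carrier_iff)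
    fix \<psi> assume \<psi>: "\<psi> \<in> carrier A"
    have "compose (carrier G) \<phi> \<psi> ` i ` carrier H = \<phi> ` \<psi> ` i ` carrier H"
      using sub by (force simp: compose_eq image_image)
    also have "\<dots> = i ` carrier H"
      using \<phi> \<psi> by (simp add: A_carrier_iff)
    finally show "\<phi> \<otimes>\<^bsub>?B\<^esub> \<psi> \<in> carrier A"
      using \<phi> \<psi> G.mla_auto_compose[of \<phi> \<psi>]
      by (simp add: A_carrier_iff mult_BijGroup mla_auto_def)
  qed
  then have "group (?B\<lparr>carrier := carrier A\<rparr>)"
    using B.group_axioms by (rule subgroup.subgroup_is_group)
  then show ?thesis
    by (simp add: Aut_sub_def)
qed

lemma C_carrier_iff:
  "(\<alpha>, \<eta>) \<in> carrier C \<longleftrightarrow> \<alpha> \<in> mla_auto H \<and> \<eta> \<in> mla_auto K \<and>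
    (\<forall>x \<in> carrier K. \<forall>a \<in> carrier H. \<alpha> (\<Gamma> x a) = \<Gamma> (\<eta> x) (\<alpha> a))"
proof -
  have "(\<forall>a \<in> carrier H. \<alpha> (\<Gamma> x (inv_into (carrier H) \<alpha> a)) = \<Gamma> (\<eta> x) a)
      \<longleftrightarrow> (\<forall>a \<in> carrier H. \<alpha> (\<Gamma> x a) = \<Gamma> (\<eta> x) (\<alpha> a))" if "\<alpha> \<in> mla_auto H" for x
    using that by (metis H.mla_auto_inv_into_left H.mla_auto_inv_into_mem H.mla_auto_inv_into_right
        H.mla_auto_mem)
  then show ?thesis
    unfolding compatible_pairs_def by auto
qed

lemma C_mult:
  assumes "(\<alpha>, \<eta>) \<in> carrier C" "(\<alpha>', \<eta>') \<in> carrier C"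
  shows "(\<alpha>, \<eta>) \<otimes>\<^bsub>C\<^esub> (\<alpha>', \<eta>') = (compose (carrier H) \<alpha> \<alpha>', compose (carrier K) \<eta> \<eta>')"
  using assms
  by (auto simp: C_carrier_iff compatible_pairs_def mla_AutoGroup_def mla_auto_def mult_BijGroup)

lemma C_one: "\<one>\<^bsub>C\<^esub> = (\<lambda>a \<in> carrier H. a, \<lambda>x \<in> carrier K. x)"
  by (simp add: compatible_pairs_def mla_AutoGroup_def BijGroup_def DirProd_def)

lemma C_group: "group C"
proof -
  let ?D = "BijGroup (carrier H) \<times>\<times> BijGroup (carrier K)"
  interpret D: group ?D
    by (intro DirProd_group group_BijGroup)
  have "subgroup (carrier C) ?D"
  proof (rule D.subgroupI)
    show "carrier C \<subseteq> carrier ?D"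
      by (auto simp: C_carrier_iff mla_auto_def BijGroup_def)
    have "\<one>\<^bsub>C\<^esub> \<in> carrier C"
      by (simp add: C_one C_carrier_iff H.mla_auto_id K.mla_auto_id)
    then show "carrier C \<noteq> {}" by blast
  next
    fix p assume p: "p \<in> carrier C"
    obtain \<alpha> \<eta> where [simp]: "p = (\<alpha>, \<eta>)" by force
    have \<alpha>\<eta>: "\<alpha> \<in> mla_auto H" "\<eta> \<in> mla_auto K"
      "\<And>x a. \<lbrakk>x \<in> carrier K; a \<in> carrier H\<rbrakk> \<Longrightarrow> \<alpha> (\<Gamma> x a) = \<Gamma> (\<eta> x) (\<alpha> a)"
      using p by (auto simp: C_carrier_iff)
    then have B: "\<alpha> \<in> Bij (carrier H)" "\<eta> \<in> Bij (carrier K)"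
      by (auto simp: mla_auto_def)
    have "inv_into (carrier H) \<alpha> (\<Gamma> x a) = \<Gamma> (inv_into (carrier K) \<eta> x) (inv_into (carrier H) \<alpha> a)"
      if "x \<in> carrier K" "a \<in> carrier H" for x a
      using \<alpha>\<eta>(3)[of "inv_into (carrier K) \<eta> x" "inv_into (carrier H) \<alpha> a"] \<alpha>\<eta>(1,2) that
      by (metis Gamma_closed H.mla_auto_inv_into_left H.mla_auto_inv_into_mem
          H.mla_auto_inv_into_right K.mla_auto_inv_into_mem K.mla_auto_inv_into_right)
    then show "inv\<^bsub>?D\<^esub> p \<in> carrier C"
      using B \<alpha>\<eta>(1,2) inv_DirProd[OF group_BijGroup group_BijGroup, of \<alpha> _ \<eta>]
      by (simp add: inv_BijGroup C_carrier_iff H.mla_auto_restrict_inv_into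
          K.mla_auto_restrict_inv_into) (simp add: BijGroup_def inv_BijGroup[unfolded BijGroup_def] C_carrier_iff H.mla_auto_restrict_inv_into
          K.mla_auto_restrict_inv_into)
    fix q assume q: "q \<in> carrier C"
    obtain \<alpha>' \<eta>' where [simp]: "q = (\<alpha>', \<eta>')" by force
    have "p \<otimes>\<^bsub>?D\<^esub> q = p \<otimes>\<^bsub>C\<^esub> q"
      by (simp add: compatible_pairs_def mla_AutoGroup_def DirProd_def)
    then show "p \<otimes>\<^bsub>?D\<^esub> q \<in> carrier C"
      using p q C_mult[of \<alpha> \<eta> \<alpha>' \<eta>']
      by (simp add: C_carrier_iff H.mla_auto_compose K.mla_auto_compose compose_eq)
  qed
  then have "group (?D\<lparr>carrier := carrier C\<rparr>)"
    using D.group_axioms by (rule subgroup.subgroup_is_group)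
  then show ?thesis
    by (simp add: compatible_pairs_def mla_AutoGroup_def DirProd_def)
qed

section \<open>Automorphisms of the extension as lifts\<close>

text \<open>Stability of \<open>i ` carrier H\<close> makes \<open>\<alpha>\<close> well defined and bijective and lets \<open>\<phi>\<close> descend to
  \<open>\<eta>\<close> on \<open>K\<close>; the map \<open>m\<close> records the \<open>H\<close>-component of \<open>\<phi> (t x)\<close>.\<close>

lemma automorphism_is_lift:
  assumes \<phi>: "\<phi> \<in> carrier A"
  obtains \<alpha> \<eta> m where "(\<alpha>, \<eta>) \<in> carrier C" "m \<in> carrier K \<rightarrow> carrier H"
    "lift_condition \<alpha> \<eta> m" "\<phi> = lift \<alpha> \<eta> m" "Pi_map \<phi> = (\<alpha>, \<eta>)"
    "\<And>a. a \<in> carrier H \<Longrightarrow> \<phi> (i a) = i (\<alpha> a)" "\<And>g. g \<in> carrier G \<Longrightarrow> \<beta> (\<phi> g) = \<eta> (\<beta> g)"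
proof -
  define \<alpha> where "\<alpha> = (\<lambda>a \<in> carrier H. inv_into (carrier H) i (\<phi> (i a)))"
  define \<eta> where "\<eta> = (\<lambda>x \<in> carrier K. \<beta> (\<phi> (t x)))"
  define m where "m = (\<lambda>x. H_part (\<phi> (t x)))"
  have auto: "\<phi> \<in> mla_auto G" and stab: "\<phi> ` i ` carrier H = i ` carrier H"
    using \<phi> by (auto simp: A_carrier_iff)
  note [simp] = G.mla_auto_mem[OF auto]
  have hom: "\<phi> \<in> mla_hom G G" and bij: "\<phi> \<in> Bij (carrier G)"
    using auto by (auto simp: mla_auto_def)
  have inj: "inj_on \<phi> (carrier G)" and surj: "\<phi> ` carrier G = carrier G"
    using bij by (auto simp: Bij_def bij_betw_def)
  interpret \<phi>: group_hom G G \<phi>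
    using mla_hom_group_hom[OF G.mult_lie_algebra_axioms G.mult_lie_algebra_axioms hom] .
  note phi_star = mla_hom_star[OF G.mult_lie_algebra_axioms G.mult_lie_algebra_axioms hom]
  have phi_i: "\<phi> (i a) = i (\<alpha> a)" and alpha_closed [simp]: "\<alpha> a \<in> carrier H"
    if "a \<in> carrier H" for a
  proof -
    have "\<phi> (i a) \<in> i ` carrier H"
      using stab that by blast
    then show "\<phi> (i a) = i (\<alpha> a)" "\<alpha> a \<in> carrier H"
      using that by (auto simp: \<alpha>_def)
  qed
  have [simp]: "m x \<in> carrier H" "\<eta> x \<in> carrier K" if "x \<in> carrier K" for x
    using that by (auto simp: m_def \<eta>_def)
  have phi_t: "\<phi> (t x) = nf (m x) (\<eta> x)" if "x \<in> carrier K" for x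
    using that by (simp add: m_def \<eta>_def nf_H_part)
  have phi_nf: "\<phi> (nf a x) = nf (\<alpha> a \<otimes>\<^bsub>H\<^esub> m x) (\<eta> x)" if "a \<in> carrier H" "x \<in> carrier K" for a x
    using that by (simp add: nf_def[of a x] phi_i phi_t i_mult_nf)
  have lift: "\<phi> = lift \<alpha> \<eta> m"
    using bij phi_nf by (intro eq_liftI) (auto simp: Bij_def)
  have beta_phi: "\<beta> (\<phi> g) = \<eta> (\<beta> g)" if "g \<in> carrier G" for g
    using that by (rule nf_cases) (simp add: phi_nf)
  have alpha_bij: "bij_betw \<alpha> (carrier H) (carrier H)"
  proof (rule bij_betw_imageI)
    show "inj_on \<alpha> (carrier H)"
    proof (rule inj_onI)
      fix a b assume ab: "a \<in> carrier H" "b \<in> carrier H" "\<alpha> a = \<alpha> b"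
      then have "i a = i b"
        using inj_onD[OF inj, of "i a" "i b"] by (simp add: phi_i)
      with ab show "a = b" by simp
    qed
    show "\<alpha> ` carrier H = carrier H"
    proof
      show "carrier H \<subseteq> \<alpha> ` carrier H"
      proof
        fix b assume b: "b \<in> carrier H"
        then have "i b \<in> \<phi> ` i ` carrier H"
          using stab by simp
        then obtain a where "a \<in> carrier H" "i b = i (\<alpha> a)"
          using phi_i by auto
        with b show "b \<in> \<alpha> ` carrier H" by auto
      qed
    qed auto
  qed
  have alpha_mult: "\<alpha> (a \<otimes>\<^bsub>H\<^esub> b) = \<alpha> a \<otimes>\<^bsub>H\<^esub> \<alpha> b" if "a \<in> carrier H" "b \<in> carrier H" for a b
  proof -
    have "i (\<alpha> (a \<otimes>\<^bsub>H\<^esub> b)) = i (\<alpha> a \<otimes>\<^bsub>H\<^esub> \<alpha> b)"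
      using that phi_i[of "a \<otimes>\<^bsub>H\<^esub> b"] by (simp add: phi_i)
    then show ?thesis
      using that by (subst (asm) i_eq_iff) auto
  qed
  then have alpha_hom: "\<alpha> \<in> hom H H"
    by (auto simp: hom_def)
  then have "\<alpha> \<one>\<^bsub>H\<^esub> = \<one>\<^bsub>H\<^esub>"
    by (metis H.is_group hom_one)
  moreover have "\<alpha> \<in> extensional (carrier H)"
    by (simp add: \<alpha>_def)
  ultimately have alpha_auto: "\<alpha> \<in> mla_auto H"
    using alpha_hom alpha_bij by (simp add: mla_auto_def mla_hom_def Bij_def H_star)
  have eta_hom: "\<eta> \<in> mla_hom K K"
    unfolding mla_hom_def mem_Collect_eq
  proof (intro conjI ballI homI)
    fix x y assume xy: "x \<in> carrier K" "y \<in> carrier K"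
    show "\<eta> (x \<otimes>\<^bsub>K\<^esub> y) = \<eta> x \<otimes>\<^bsub>K\<^esub> \<eta> y"
      using xy beta_phi[of "t x \<otimes>\<^bsub>G\<^esub> t y"] by (simp add: beta_phi)
    show "\<eta> (x \<star>\<^bsub>K\<^esub> y) = \<eta> x \<star>\<^bsub>K\<^esub> \<eta> y"
      using xy beta_phi[of "t x \<star>\<^bsub>G\<^esub> t y"] by (simp add: beta_phi phi_star)
  qed simp
  have eta_bij: "bij_betw \<eta> (carrier K) (carrier K)"
  proof (rule bij_betw_imageI)
    show "inj_on \<eta> (carrier K)"
    proof (rule inj_onI)
      fix x y assume xy: "x \<in> carrier K" "y \<in> carrier K" "\<eta> x = \<eta> y"
      \<comment> \<open>If \<open>\<eta> x = \<eta> y\<close>, then \<open>\<phi> (t x)\<close> and \<open>\<phi> (t y)\<close> differ by an element of \<open>H\<close>, which lifts along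
        \<open>\<alpha>\<close>.\<close>
      have "m y \<otimes>\<^bsub>H\<^esub> inv\<^bsub>H\<^esub> (m x) \<in> \<alpha> ` carrier H"
        using alpha_bij xy by (simp add: bij_betw_imp_surj_on)
      then obtain a where a: "a \<in> carrier H" "\<alpha> a = m y \<otimes>\<^bsub>H\<^esub> inv\<^bsub>H\<^esub> (m x)"
        by auto
      have "nf a x = t y"
        using xy a inj_onD[OF inj, of "nf a x" "t y"] by (simp add: phi_nf phi_t H.m_assoc)
      then show "x = y"
        using xy a by (metis beta_nf beta_t)
    qed
    show "\<eta> ` carrier K = carrier K"
    proof
      show "carrier K \<subseteq> \<eta> ` carrier K"
      proof
        fix y assume y: "y \<in> carrier K"
        then obtain g where "g \<in> carrier G" "t y = \<phi> g"
          using surj t_closed[OF y] by (metis imageE)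
        then show "y \<in> \<eta> ` carrier K"
          using y beta_phi[of g] beta_t[OF y] \<beta>.hom_closed by (metis imageI)
      qed
    qed auto
  qed
  have eta_auto: "\<eta> \<in> mla_auto K"
    using eta_hom eta_bij by (auto simp: mla_auto_def Bij_def \<eta>_def)
  have comp: "\<alpha> (\<Gamma> x a) = \<Gamma> (\<eta> x) (\<alpha> a)" if "x \<in> carrier K" "a \<in> carrier H" for x a
  proof -
    have "i (\<alpha> (\<Gamma> x a)) = i (\<Gamma> (\<eta> x) (\<alpha> a))"
      using that phi_star[of "t x" "i a"] by (simp add: star_i phi_i beta_phi)
    then show ?thesis
      using that by (subst (asm) i_eq_iff) auto
  qed
  show thesis
  proof
    show "(\<alpha>, \<eta>) \<in> carrier C"
      using alpha_auto eta_auto comp by (simp add: C_carrier_iff)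
    show "m \<in> carrier K \<rightarrow> carrier H" by simp
    then show "lift_condition \<alpha> \<eta> m"
      using lift_mla_hom_iff[OF alpha_hom eta_hom _ comp] hom lift by simp
    show "Pi_map \<phi> = (\<alpha>, \<eta>)"
      by (simp add: wells_Pi_def \<alpha>_def \<eta>_def)
  qed (rule lift phi_i beta_phi; assumption)+
qed

text \<open>Evaluate the first equation at \<open>x = y = \<one>\<close>, where \<open>f\<close> is trivial.\<close>

lemma lift_condition_one:
  assumes C: "(\<alpha>, \<eta>) \<in> carrier C" and m: "m \<in> carrier K \<rightarrow> carrier H"
    and L: "lift_condition \<alpha> \<eta> m"
  shows "m \<one>\<^bsub>K\<^esub> = \<one>\<^bsub>H\<^esub>"
proof -
  have "\<alpha> \<in> hom H H" "\<eta> \<in> hom K K"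
    using C by (auto simp: C_carrier_iff mla_auto_def mla_hom_def)
  then have "\<alpha> \<one>\<^bsub>H\<^esub> = \<one>\<^bsub>H\<^esub>" "\<eta> \<one>\<^bsub>K\<^esub> = \<one>\<^bsub>K\<^esub>"
    by (metis H.is_group hom_one, metis K.is_group hom_one)
  moreover have m1: "m \<one>\<^bsub>K\<^esub> \<in> carrier H"
    using m by auto
  ultimately have "m \<one>\<^bsub>K\<^esub> \<otimes>\<^bsub>H\<^esub> m \<one>\<^bsub>K\<^esub> = m \<one>\<^bsub>K\<^esub>"
    using L[unfolded lift_condition_def, rule_format, of "\<one>\<^bsub>K\<^esub>" "\<one>\<^bsub>K\<^esub>"]
      ml_cocycle_normalized(1)[OF ext_ml_cocycle]
    by simp
  then show ?thesis
    using m1 by simp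
qed

lemma lift_automorphism:
  assumes C: "(\<alpha>, \<eta>) \<in> carrier C" and m: "m \<in> carrier K \<rightarrow> carrier H"
    and L: "lift_condition \<alpha> \<eta> m"
  shows "lift \<alpha> \<eta> m \<in> carrier A" "Pi_map (lift \<alpha> \<eta> m) = (\<alpha>, \<eta>)"
proof -
  have auto: "\<alpha> \<in> mla_auto H" "\<eta> \<in> mla_auto K"
    and comp: "\<And>x a. \<lbrakk>x \<in> carrier K; a \<in> carrier H\<rbrakk> \<Longrightarrow> \<alpha> (\<Gamma> x a) = \<Gamma> (\<eta> x) (\<alpha> a)"
    using C by (auto simp: C_carrier_iff)
  have bij: "bij_betw \<alpha> (carrier H) (carrier H)" "bij_betw \<eta> (carrier K) (carrier K)"
    and ext: "\<alpha> \<in> extensional (carrier H)" "\<eta> \<in> extensional (carrier K)"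
    and hom: "\<alpha> \<in> hom H H" "\<eta> \<in> mla_hom K K"
    using auto by (auto simp: mla_auto_def Bij_def mla_hom_def)
  interpret \<alpha>: group_hom H H \<alpha>
    using hom(1) by unfold_locales
  interpret \<eta>: group_hom K K \<eta>
    using mla_hom_group_hom[OF K.mult_lie_algebra_axioms K.mult_lie_algebra_axioms hom(2)] .
  have [simp]: "m x \<in> carrier H" if "x \<in> carrier K" for x
    using m that by auto
  have m_one: "m \<one>\<^bsub>K\<^esub> = \<one>\<^bsub>H\<^esub>"
    by (rule lift_condition_one[OF C m L])
  let ?\<phi> = "lift \<alpha> \<eta> m"
  have lift_hom: "?\<phi> \<in> mla_hom G G"
    using lift_mla_hom_iff[OF hom m comp] L by simp
  have lift_i: "?\<phi> (i a) = i (\<alpha> a)" if "a \<in> carrier H" for a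
    using that lift_nf[of a "\<one>\<^bsub>K\<^esub>" \<alpha> \<eta> m] by (simp add: nf_one_right m_one)
  have "inj_on ?\<phi> (carrier G)"
  proof (rule inj_onI)
    fix g g' assume g: "g \<in> carrier G" "g' \<in> carrier G" "?\<phi> g = ?\<phi> g'"
    obtain a x b y where *: "a \<in> carrier H" "x \<in> carrier K" "g = nf a x"
        "b \<in> carrier H" "y \<in> carrier K" "g' = nf b y"
      using g by (metis nf_cases)
    then have "\<alpha> a \<otimes>\<^bsub>H\<^esub> m x = \<alpha> b \<otimes>\<^bsub>H\<^esub> m y" "\<eta> x = \<eta> y"
      using g by (auto simp: lift_nf nf_eq_iff)
    moreover from this have "x = y"
      using bij * by (auto simp: bij_betw_def inj_on_def)
    ultimately have "\<alpha> a = \<alpha> b"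
      using * by simp
    then have "a = b"
      using bij * by (auto simp: bij_betw_def inj_on_def)
    with * \<open>x = y\<close> show "g = g'" by simp
  qed
  moreover have "?\<phi> ` carrier G = carrier G"
  proof
    show "?\<phi> ` carrier G \<subseteq> carrier G"
      by (auto simp: lift_def)
    show "carrier G \<subseteq> ?\<phi> ` carrier G"
    proof
      fix g assume "g \<in> carrier G"
      then obtain b y where b: "b \<in> carrier H" "y \<in> carrier K" "g = nf b y"
        by (rule nf_cases)
      obtain x where x: "x \<in> carrier K" "y = \<eta> x"
        using bij b by (metis bij_betw_imp_surj_on imageE)
      have "b \<otimes>\<^bsub>H\<^esub> inv\<^bsub>H\<^esub> (m x) \<in> \<alpha> ` carrier H"
        using bij b x by (simp add: bij_betw_imp_surj_on)
      then obtain a where a: "a \<in> carrier H" "\<alpha> a = b \<otimes>\<^bsub>H\<^esub> inv\<^bsub>H\<^esub> (m x)"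
        by auto
      have "g = ?\<phi> (nf a x)"
        using a b x by (simp add: lift_nf H.m_assoc)
      then show "g \<in> ?\<phi> ` carrier G"
        using a x by simp
    qed
  qed
  ultimately have "?\<phi> \<in> mla_auto G"
    using lift_hom lift_extensional by (auto simp: mla_auto_def Bij_def bij_betw_def)
  moreover have "?\<phi> ` i ` carrier H = i ` \<alpha> ` carrier H"
    by (auto simp: image_image lift_i)
  ultimately show "?\<phi> \<in> carrier A"
    using bij by (simp add: A_carrier_iff bij_betw_imp_surj_on)
  have "inv_into (carrier H) i (?\<phi> (i a)) = \<alpha> a" if "a \<in> carrier H" for a
    using that by (simp add: lift_i)
  moreover have "\<beta> (?\<phi> (t x)) = \<eta> x" if "x \<in> carrier K" for x
    using that by (simp add: t_eq_nf lift_nf)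
  ultimately show "Pi_map ?\<phi> = (\<alpha>, \<eta>)"
    using ext by (auto simp: wells_Pi_def extensional_def restrict_def fun_eq_iff)
qed

lemma Pi_image_iff:
  assumes "(\<alpha>, \<eta>) \<in> carrier C"
  shows "(\<alpha>, \<eta>) \<in> Pi_map ` carrier A \<longleftrightarrow> (\<exists>m \<in> carrier K \<rightarrow> carrier H. lift_condition \<alpha> \<eta> m)"
proof
  assume "(\<alpha>, \<eta>) \<in> Pi_map ` carrier A"
  then obtain \<phi> where \<phi>: "\<phi> \<in> carrier A" "Pi_map \<phi> = (\<alpha>, \<eta>)" by auto
  from \<phi>(1) show "\<exists>m \<in> carrier K \<rightarrow> carrier H. lift_condition \<alpha> \<eta> m"
    by (rule automorphism_is_lift) (use \<phi>(2) in auto)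
next
  assume "\<exists>m \<in> carrier K \<rightarrow> carrier H. lift_condition \<alpha> \<eta> m"
  then show "(\<alpha>, \<eta>) \<in> Pi_map ` carrier A"
    using lift_automorphism[OF assms] by (metis imageI)
qed

lemma Pi_group_hom: "group_hom A C Pi_map"
proof (intro group_hom.intro group_hom_axioms.intro A_group C_group homI)
  fix \<phi> assume "\<phi> \<in> carrier A"
  then show "Pi_map \<phi> \<in> carrier C"
    by (rule automorphism_is_lift) simp
next
  fix \<phi> \<psi> assume \<phi>\<psi>: "\<phi> \<in> carrier A" "\<psi> \<in> carrier A"
  obtain \<alpha> \<eta> where \<phi>: "(\<alpha>, \<eta>) \<in> carrier C" "Pi_map \<phi> = (\<alpha>, \<eta>)"
    "\<And>a. a \<in> carrier H \<Longrightarrow> \<phi> (i a) = i (\<alpha> a)" "\<And>g. g \<in> carrier G \<Longrightarrow> \<beta> (\<phi> g) = \<eta> (\<beta> g)"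
    using \<phi>\<psi>(1) by (rule automorphism_is_lift) blast
  obtain \<alpha>' \<eta>' where \<psi>: "(\<alpha>', \<eta>') \<in> carrier C" "Pi_map \<psi> = (\<alpha>', \<eta>')"
    "\<And>a. a \<in> carrier H \<Longrightarrow> \<psi> (i a) = i (\<alpha>' a)" "\<And>g. g \<in> carrier G \<Longrightarrow> \<beta> (\<psi> g) = \<eta>' (\<beta> g)"
    using \<phi>\<psi>(2) by (rule automorphism_is_lift) blast
  have [simp]: "\<alpha>' a \<in> carrier H" "\<alpha> a \<in> carrier H" if "a \<in> carrier H" for a
    using \<psi>(1) \<phi>(1) that by (auto simp: C_carrier_iff)
  have [simp]: "\<psi> g \<in> carrier G" if "g \<in> carrier G" for g
    using \<phi>\<psi>(2) that by (auto simp: A_carrier_iff)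
  show "Pi_map (\<phi> \<otimes>\<^bsub>A\<^esub> \<psi>) = Pi_map \<phi> \<otimes>\<^bsub>C\<^esub> Pi_map \<psi>"
    unfolding A_mult[OF \<phi>\<psi>] \<phi>(2) \<psi>(2) C_mult[OF \<phi>(1) \<psi>(1)]
    by (auto simp: wells_Pi_def compose_eq \<phi>(3,4) \<psi>(3,4) compose_def intro!: restrict_ext)
qed

section \<open>The embedding of the 1-cocycles\<close>

abbreviation "idH \<equiv> \<lambda>a \<in> carrier H. a"
abbreviation "idK \<equiv> \<lambda>x \<in> carrier K. x"

lemma id_in_C: "(idH, idK) \<in> carrier C"
  using group.is_monoid[OF C_group] monoid.one_closed C_one by metis

text \<open>The map \<open>\<iota>\<close> is thus covered by the results on lifts, with both automorphisms trivial.\<close>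

lemma iota_eq_lift:
  assumes "\<nu> \<in> carrier K \<rightarrow> carrier H"
  shows "iota \<nu> = lift idH idK \<nu>"
proof (rule eq_liftI)
  show "iota \<nu> \<in> extensional (carrier G)"
    by (simp add: wells_iota_def)
next
  fix a x assume "a \<in> carrier H" "x \<in> carrier K"
  moreover from this have "\<nu> x \<in> carrier H"
    using assms by auto
  ultimately show "iota \<nu> (nf a x) = nf (idH a \<otimes>\<^bsub>H\<^esub> \<nu> x) (idK x)"
    by (simp add: wells_iota_def nf_def G.m_assoc)
qed

text \<open>Over the identities \<open>f\<close> and \<open>h\<close> occur on both sides of the lifting equations and cancel.\<close>

lemma lift_condition_id_iff:
  assumes "\<nu> \<in> carrier K \<rightarrow> carrier H"
  shows "lift_condition idH idK \<nu> \<longleftrightarrow> restrict \<nu> (carrier K) \<in> carrier (Z1_ML K H \<Gamma>)"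
proof -
  have [simp]: "\<nu> x \<in> carrier H" if "x \<in> carrier K" for x
    using assms that by auto
  have "\<nu> x \<otimes>\<^bsub>H\<^esub> \<nu> y \<otimes>\<^bsub>H\<^esub> f (x, y) = f (x, y) \<otimes>\<^bsub>H\<^esub> \<nu> (x \<otimes>\<^bsub>K\<^esub> y)
      \<longleftrightarrow> \<nu> (x \<otimes>\<^bsub>K\<^esub> y) = \<nu> x \<otimes>\<^bsub>H\<^esub> \<nu> y"
    if "x \<in> carrier K" "y \<in> carrier K" for x y
    using that H.m_comm[of "f (x, y)" "\<nu> (x \<otimes>\<^bsub>K\<^esub> y)"] by auto
  moreover have "\<Gamma> x (\<nu> y) \<otimes>\<^bsub>H\<^esub> \<Gamma> y (inv\<^bsub>H\<^esub> (\<nu> x)) \<otimes>\<^bsub>H\<^esub> h (x, y) = h (x, y) \<otimes>\<^bsub>H\<^esub> \<nu> (x \<star>\<^bsub>K\<^esub> y)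
      \<longleftrightarrow> \<nu> (x \<star>\<^bsub>K\<^esub> y) = \<Gamma> x (\<nu> y) \<otimes>\<^bsub>H\<^esub> \<Gamma> y (inv\<^bsub>H\<^esub> (\<nu> x))"
    if "x \<in> carrier K" "y \<in> carrier K" for x y
    using that H.m_comm[of "h (x, y)" "\<nu> (x \<star>\<^bsub>K\<^esub> y)"] by auto
  ultimately show ?thesis
    by (simp add: lift_condition_def Z1_ML_def)
qed

lemma Z1_funcset: "\<nu> \<in> carrier (Z1_ML K H \<Gamma>) \<Longrightarrow> \<nu> \<in> carrier K \<rightarrow>\<^sub>E carrier H"
  by (simp add: Z1_ML_def)

lemma iota_in_A:
  assumes "\<nu> \<in> carrier (Z1_ML K H \<Gamma>)"
  shows "iota \<nu> \<in> carrier A" "Pi_map (iota \<nu>) = \<one>\<^bsub>C\<^esub>"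
proof -
  have \<nu>: "\<nu> \<in> carrier K \<rightarrow> carrier H" "restrict \<nu> (carrier K) = \<nu>"
    using Z1_funcset[OF assms] by (auto simp: PiE_restrict PiE_iff)
  then have "lift_condition idH idK \<nu>"
    using assms lift_condition_id_iff by simp
  then show "iota \<nu> \<in> carrier A" "Pi_map (iota \<nu>) = \<one>\<^bsub>C\<^esub>"
    using lift_automorphism[OF id_in_C \<nu>(1)] iota_eq_lift[OF \<nu>(1)] by (simp_all add: C_one)
qed

lemma iota_nf:
  assumes "\<nu> \<in> carrier (Z1_ML K H \<Gamma>)" "a \<in> carrier H" "x \<in> carrier K"
  shows "iota \<nu> (nf a x) = nf (a \<otimes>\<^bsub>H\<^esub> \<nu> x) x"
  using assms Z1_funcset[OF assms(1)] by (simp add: iota_eq_lift PiE_iff lift_nf)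

lemma iota_group_hom: "group_hom (Z1_ML K H \<Gamma>) A iota"
proof (intro group_hom.intro group_hom_axioms.intro A_group homI)
  show "group (Z1_ML K H \<Gamma>)"
    using Z1_ML_comm_group by (rule comm_group.axioms)
next
  fix \<nu> assume "\<nu> \<in> carrier (Z1_ML K H \<Gamma>)"
  then show "iota \<nu> \<in> carrier A" by (rule iota_in_A)
next
  fix \<nu> \<nu>' assume \<nu>: "\<nu> \<in> carrier (Z1_ML K H \<Gamma>)" and \<nu>': "\<nu>' \<in> carrier (Z1_ML K H \<Gamma>)"
  let ?p = "\<nu> \<otimes>\<^bsub>Z1_ML K H \<Gamma>\<^esub> \<nu>'"
  have p: "?p \<in> carrier (Z1_ML K H \<Gamma>)"
    using comm_group.axioms(2)[OF Z1_ML_comm_group] \<nu> \<nu>'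
    by (simp add: group.is_monoid monoid.m_closed)
  have [simp]: "\<nu> x \<in> carrier H" "\<nu>' x \<in> carrier H" if "x \<in> carrier K" for x
    using Z1_funcset[OF \<nu>] Z1_funcset[OF \<nu>'] that by auto
  have "iota ?p = compose (carrier G) (iota \<nu>) (iota \<nu>')"
  proof (rule extensionalityI)
    show "iota ?p \<in> extensional (carrier G)"
      by (simp add: wells_iota_def)
    fix g assume "g \<in> carrier G"
    then obtain a x where g: "a \<in> carrier H" "x \<in> carrier K" "g = nf a x"
      by (rule nf_cases)
    have "?p x = \<nu> x \<otimes>\<^bsub>H\<^esub> \<nu>' x"
      using g by (simp add: Z1_ML_def)
    then show "iota ?p g = compose (carrier G) (iota \<nu>) (iota \<nu>') g"
      using g by (simp add: compose_eq iota_nf[OF p] iota_nf[OF \<nu>] iota_nf[OF \<nu>'] H.m_ac)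
  qed simp
  also have "\<dots> = iota \<nu> \<otimes>\<^bsub>A\<^esub> iota \<nu>'"
    using iota_in_A(1)[OF \<nu>] iota_in_A(1)[OF \<nu>'] by (simp add: A_mult)
  finally show "iota ?p = iota \<nu> \<otimes>\<^bsub>A\<^esub> iota \<nu>'" .
qed

lemma iota_inj: "inj_on iota (carrier (Z1_ML K H \<Gamma>))"
proof (rule inj_onI)
  fix \<nu> \<nu>' assume *: "\<nu> \<in> carrier (Z1_ML K H \<Gamma>)" "\<nu>' \<in> carrier (Z1_ML K H \<Gamma>)" "iota \<nu> = iota \<nu>'"
  note E = Z1_funcset[OF *(1)] Z1_funcset[OF *(2)]
  show "\<nu> = \<nu>'"
  proof (rule PiE_ext[OF E])
    fix x assume x: "x \<in> carrier K"
    have "nf (\<nu> x) x = nf (\<nu>' x) x"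
      using iota_nf[OF *(1), of "\<one>\<^bsub>H\<^esub>" x] iota_nf[OF *(2), of "\<one>\<^bsub>H\<^esub>" x] x *(3)
        PiE_mem[OF E(1) x] PiE_mem[OF E(2) x] by simp
    then show "\<nu> x = \<nu>' x"
      using x PiE_mem[OF E(1) x] PiE_mem[OF E(2) x] by (simp add: nf_eq_iff)
  qed
qed

lemma iota_image: "iota ` carrier (Z1_ML K H \<Gamma>) = kernel A C Pi_map"
proof
  show "iota ` carrier (Z1_ML K H \<Gamma>) \<subseteq> kernel A C Pi_map"
    using iota_in_A by (auto simp: kernel_def)
  show "kernel A C Pi_map \<subseteq> iota ` carrier (Z1_ML K H \<Gamma>)"
  proof
    fix \<phi> assume "\<phi> \<in> kernel A C Pi_map"
    then have \<phi>: "\<phi> \<in> carrier A" "Pi_map \<phi> = (idH, idK)"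
      by (auto simp: kernel_def C_one)
    from \<phi>(1) obtain m where m: "m \<in> carrier K \<rightarrow> carrier H" "lift_condition idH idK m"
      "\<phi> = lift idH idK m"
      by (rule automorphism_is_lift) (use \<phi>(2) in auto)
    let ?\<nu> = "restrict m (carrier K)"
    have "?\<nu> \<in> carrier (Z1_ML K H \<Gamma>)"
      using m lift_condition_id_iff by simp
    moreover have "\<phi> = iota ?\<nu>"
      using m by (subst iota_eq_lift) (auto simp: lift_def intro!: restrict_ext)
    ultimately show "\<phi> \<in> iota ` carrier (Z1_ML K H \<Gamma>)" by blast
  qed
qed

end

section \<open>The obstruction class of a compatible pair\<close>

locale compatible_pair = center_extension_transversal H G K i \<beta> t
  for H :: "('h, 'l) mult_lie_scheme"
    and G :: "('g, 'm) mult_lie_scheme"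
    and K :: "('k, 'n) mult_lie_scheme"
    and i :: "'h \<Rightarrow> 'g" and \<beta> :: "'g \<Rightarrow> 'k" and t :: "'k \<Rightarrow> 'g" +
  fixes \<alpha> :: "'h \<Rightarrow> 'h" and \<eta> :: "'k \<Rightarrow> 'k"
  assumes pair: "(\<alpha>, \<eta>) \<in> carrier (compatible_pairs H K (ext_Gamma H G K i t))"
begin

lemma alpha_auto: "\<alpha> \<in> mla_auto H"
  and eta_auto: "\<eta> \<in> mla_auto K"
  and compatible: "\<lbrakk>x \<in> carrier K; a \<in> carrier H\<rbrakk> \<Longrightarrow> \<alpha> (\<Gamma> x a) = \<Gamma> (\<eta> x) (\<alpha> a)"
  using pair by (auto simp: C_carrier_iff)

lemma eta_hom: "\<eta> \<in> mla_hom K K"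
  using eta_auto by (simp add: mla_auto_def)

sublocale \<alpha>: group_hom H H \<alpha>
  using alpha_auto by unfold_locales (simp add: mla_auto_def mla_hom_def)

sublocale \<eta>: group_hom K K \<eta>
  using mla_hom_group_hom[OF K.mult_lie_algebra_axioms K.mult_lie_algebra_axioms eta_hom] .

abbreviation "\<alpha>' \<equiv> \<lambda>a \<in> carrier H. inv_into (carrier H) \<alpha> a"

lemma alpha'_hom: "\<alpha>' \<in> hom H H"
  using H.mla_auto_restrict_inv_into[OF alpha_auto] by (simp add: mla_auto_def mla_hom_def)

lemma alpha'_closed [simp]: "a \<in> carrier H \<Longrightarrow> inv_into (carrier H) \<alpha> a \<in> carrier H"
  and alpha_alpha' [simp]: "a \<in> carrier H \<Longrightarrow> \<alpha> (inv_into (carrier H) \<alpha> a) = a"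
  and alpha'_alpha [simp]: "a \<in> carrier H \<Longrightarrow> inv_into (carrier H) \<alpha> (\<alpha> a) = a"
  using alpha_auto by simp_all

abbreviation "\<Gamma>' \<equiv> twist K (ext_Gamma H G K i t) \<eta>"

lemma Gamma'_eq: "x \<in> carrier K \<Longrightarrow> \<Gamma>' x = \<Gamma> (\<eta> x)"
  by (simp add: twist_def)

sublocale twisted: ml_coefficients H K "twist K (ext_Gamma H G K i t) \<eta>"
  by unfold_locales (simp add: twist_def Gamma_hom)

text \<open>Compatibility, read as: \<open>\<alpha>\<inverse>\<close> intertwines \<open>\<Gamma> \<circ> \<eta>\<close> and \<open>\<Gamma>\<close>.\<close>

lemma alpha'_Gamma':
  assumes "x \<in> carrier K" "a \<in> carrier H"
  shows "\<Gamma> x (\<alpha>' a) = \<alpha>' (\<Gamma>' x a)"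
proof -
  have "\<Gamma>' x a = \<alpha> (\<Gamma> x (\<alpha>' a))"
    using assms by (simp add: Gamma'_eq compatible)
  then show ?thesis
    using assms by simp
qed

abbreviation "s \<equiv> wells_s H K f (\<alpha>, \<eta>)"
abbreviation "s' \<equiv> wells_s H K h (\<alpha>, \<eta>)"
abbreviation "T \<equiv> wells_triple H K \<Gamma> f h (\<alpha>, \<eta>)"
abbreviation "T\<^sub>0 \<equiv> coeff_pullback H K \<alpha> T"

lemma T_eq: "T = (s, s', \<Gamma>')"
  by (simp add: wells_triple_def)

lemma s_eq [simp]:
  "\<lbrakk>x \<in> carrier K; y \<in> carrier K\<rbrakk> \<Longrightarrow> s (x, y) = f (\<eta> x, \<eta> y) \<otimes>\<^bsub>H\<^esub> inv\<^bsub>H\<^esub> (\<alpha> (f (x, y)))"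
  "\<lbrakk>x \<in> carrier K; y \<in> carrier K\<rbrakk> \<Longrightarrow> s' (x, y) = h (\<eta> x, \<eta> y) \<otimes>\<^bsub>H\<^esub> inv\<^bsub>H\<^esub> (\<alpha> (h (x, y)))"
  by (simp_all add: wells_s_def)

text \<open>\<open>(s, s')\<close> is the product of two pairs, \<open>(f, h)\<close> reindexed along \<open>\<eta>\<close> and the image of \<open>(f, h)\<close>
  under \<open>a \<mapsto> \<alpha>(a)\<inverse>\<close>; both are cocycles for \<open>\<Gamma> \<circ> \<eta>\<close>.\<close>

lemma T_cocycle: "ml_cocycle K H (s, s', \<Gamma>')"
proof -
  have "(\<lambda>a. inv\<^bsub>H\<^esub> (\<alpha> a)) \<in> hom H H"
    by (auto simp: hom_def H.inv_mult)
  then have "ml_cocycle K H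
      (\<lambda>p \<in> KK. inv\<^bsub>H\<^esub> (\<alpha> (f p)), \<lambda>p \<in> KK. inv\<^bsub>H\<^esub> (\<alpha> (h p)), \<Gamma>')"
    by (rule ml_cocycle_map[OF ext_ml_cocycle])
      (simp add: Gamma'_eq compatible Gamma_inv)
  note twisted.ml_cocycle_mult[OF ml_cocycle_reindex[OF ext_ml_cocycle eta_hom] this]
  moreover have "s = (\<lambda>p \<in> KK. (\<lambda>(x, y) \<in> KK. f (\<eta> x, \<eta> y)) p \<otimes>\<^bsub>H\<^esub> (\<lambda>p \<in> KK. inv\<^bsub>H\<^esub> (\<alpha> (f p))) p)"
    "s' = (\<lambda>p \<in> KK. (\<lambda>(x, y) \<in> KK. h (\<eta> x, \<eta> y)) p \<otimes>\<^bsub>H\<^esub> (\<lambda>p \<in> KK. inv\<^bsub>H\<^esub> (\<alpha> (h p))) p)"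
    by (auto simp: wells_s_def intro!: restrict_ext)
  ultimately show ?thesis by simp
qed

lemma s_mem: "p \<in> KK \<Longrightarrow> s p \<in> carrier H" "p \<in> KK \<Longrightarrow> s' p \<in> carrier H"
  using ml_cocycle_f[OF T_cocycle] ml_cocycle_h[OF T_cocycle] by auto

text \<open>Transport along \<open>\<alpha>\<close> turns \<open>\<Gamma> \<circ> \<eta>\<close> back into \<open>\<Gamma>\<close>; as functions on the whole type they agree because
  both are extensional.\<close>

lemma T0_eq: "T\<^sub>0 = (\<lambda>p \<in> KK. \<alpha>' (s p), \<lambda>p \<in> KK. \<alpha>' (s' p), \<Gamma>)"
proof -
  have "(\<lambda>x \<in> carrier K. \<lambda>a \<in> carrier H. inv_into (carrier H) \<alpha> (\<Gamma>' x (\<alpha> a))) = \<Gamma>"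
  proof (rule extensionalityI)
    fix x assume x: "x \<in> carrier K"
    have "(\<lambda>a \<in> carrier H. inv_into (carrier H) \<alpha> (\<Gamma>' x (\<alpha> a))) = \<Gamma> x"
    proof (rule extensionalityI)
      show "\<Gamma> x \<in> extensional (carrier H)"
        using x by (simp add: ext_Gamma_def)
    qed (use x in \<open>auto simp: Gamma'_eq compatible[symmetric]\<close>)
    then show "(\<lambda>x \<in> carrier K. \<lambda>a \<in> carrier H. inv_into (carrier H) \<alpha> (\<Gamma>' x (\<alpha> a))) x = \<Gamma> x"
      using x by simp
  qed (auto simp: ext_Gamma_def)
  then show ?thesis
    using s_mem by (auto simp: T_eq coeff_pullback_def intro!: restrict_ext)
qed

lemma T0_cocycle: "ml_cocycle K H (\<lambda>p \<in> KK. \<alpha>' (s p), \<lambda>p \<in> KK. \<alpha>' (s' p), \<Gamma>)"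
  by (rule twisted.ml_cocycle_map[OF T_cocycle alpha'_hom]) (rule alpha'_Gamma')

lemma T_in_Z2: "T \<in> carrier (Z2_ML K H \<Gamma>')" and T0_in_Z2: "T\<^sub>0 \<in> carrier (Z2_ML K H \<Gamma>)"
  unfolding T_eq twisted.Z2_ML_carrier_iff T0_eq[unfolded T_eq] Z2_ML_carrier_iff
  using T_cocycle T0_cocycle by blast+

text \<open>With \<open>l(x) = m(x)\<inverse>\<close> the coboundary equations for \<open>(s, s')\<close> are the lifting equations for \<open>m\<close>,
  rearranged.\<close>

lemma cobounds_T_iff:
  "(\<exists>l. cobounds K H l T) \<longleftrightarrow> (\<exists>m \<in> carrier K \<rightarrow> carrier H. lift_condition \<alpha> \<eta> m)"
proof -
  have eq: "(s (x, y) = inv\<^bsub>H\<^esub> (m x) \<otimes>\<^bsub>H\<^esub> inv\<^bsub>H\<^esub> (m y) \<otimes>\<^bsub>H\<^esub> inv\<^bsub>H\<^esub> (inv\<^bsub>H\<^esub> (m (x \<otimes>\<^bsub>K\<^esub> y)))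
        \<longleftrightarrow> m x \<otimes>\<^bsub>H\<^esub> m y \<otimes>\<^bsub>H\<^esub> f (\<eta> x, \<eta> y) = \<alpha> (f (x, y)) \<otimes>\<^bsub>H\<^esub> m (x \<otimes>\<^bsub>K\<^esub> y)) \<and>
      (s' (x, y) = \<Gamma>' x (inv\<^bsub>H\<^esub> (m y)) \<otimes>\<^bsub>H\<^esub> \<Gamma>' y (inv\<^bsub>H\<^esub> (inv\<^bsub>H\<^esub> (m x)))
            \<otimes>\<^bsub>H\<^esub> inv\<^bsub>H\<^esub> (inv\<^bsub>H\<^esub> (m (x \<star>\<^bsub>K\<^esub> y)))
        \<longleftrightarrow> \<Gamma> (\<eta> x) (m y) \<otimes>\<^bsub>H\<^esub> \<Gamma> (\<eta> y) (inv\<^bsub>H\<^esub> (m x)) \<otimes>\<^bsub>H\<^esub> h (\<eta> x, \<eta> y)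
          = \<alpha> (h (x, y)) \<otimes>\<^bsub>H\<^esub> m (x \<star>\<^bsub>K\<^esub> y))"
    if "m \<in> carrier K \<rightarrow> carrier H" and xy: "x \<in> carrier K" "y \<in> carrier K" for m x y
  proof -
    have [simp]: "m x \<in> carrier H" if "x \<in> carrier K" for x
      using \<open>m \<in> _\<close> that by auto
    show ?thesis
      using xy H.inv_mult_eq_iff[of "f (\<eta> x, \<eta> y)" "\<alpha> (f (x, y))" "m x \<otimes>\<^bsub>H\<^esub> m y" "m (x \<otimes>\<^bsub>K\<^esub> y)"]
        H.inv_mult_eq_iff[of "h (\<eta> x, \<eta> y)" "\<alpha> (h (x, y))"
          "\<Gamma> (\<eta> x) (m y) \<otimes>\<^bsub>H\<^esub> \<Gamma> (\<eta> y) (inv\<^bsub>H\<^esub> (m x))" "m (x \<star>\<^bsub>K\<^esub> y)"]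
      by (simp add: H.inv_mult Gamma'_eq Gamma_inv)
  qed
  show ?thesis
  proof
    assume "\<exists>l. cobounds K H l T"
    then obtain l where l: "cobounds K H l T" ..
    then have l_closed: "l x \<in> carrier H" if "x \<in> carrier K" for x
      using that by (auto simp: T_eq cobounds_def)
    let ?m = "\<lambda>x. inv\<^bsub>H\<^esub> (l x)"
    have m: "?m \<in> carrier K \<rightarrow> carrier H"
      using l_closed by simp
    have "lift_condition \<alpha> \<eta> ?m"
      unfolding lift_condition_def
      using l eq[OF m] l_closed by (simp add: T_eq cobounds_def)
    with m show "\<exists>m \<in> carrier K \<rightarrow> carrier H. lift_condition \<alpha> \<eta> m" by blast
  next
    assume "\<exists>m \<in> carrier K \<rightarrow> carrier H. lift_condition \<alpha> \<eta> m"
    then obtain m where m: "m \<in> carrier K \<rightarrow> carrier H" "lift_condition \<alpha> \<eta> m" ..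
    have "cobounds K H (\<lambda>x. inv\<^bsub>H\<^esub> (m x)) T"
      unfolding T_eq cobounds_def prod.case
    proof (intro conjI ballI)
      show "inv\<^bsub>H\<^esub> (m \<one>\<^bsub>K\<^esub>) = \<one>\<^bsub>H\<^esub>"
        using lift_condition_one[OF pair m] by simp
      fix x y assume "x \<in> carrier K" "y \<in> carrier K"
      then show "s (x, y) = inv\<^bsub>H\<^esub> (m x) \<otimes>\<^bsub>H\<^esub> inv\<^bsub>H\<^esub> (m y) \<otimes>\<^bsub>H\<^esub> inv\<^bsub>H\<^esub> (inv\<^bsub>H\<^esub> (m (x \<otimes>\<^bsub>K\<^esub> y)))"
        "s' (x, y) = \<Gamma>' x (inv\<^bsub>H\<^esub> (m y)) \<otimes>\<^bsub>H\<^esub> \<Gamma>' y (inv\<^bsub>H\<^esub> (inv\<^bsub>H\<^esub> (m x)))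
            \<otimes>\<^bsub>H\<^esub> inv\<^bsub>H\<^esub> (inv\<^bsub>H\<^esub> (m (x \<star>\<^bsub>K\<^esub> y)))"
        using eq[OF m(1)] m(2) unfolding lift_condition_def by blast+
    qed (use m in auto)
    then show "\<exists>l. cobounds K H l T" by blast
  qed
qed

text \<open>Witnesses are carried forth by \<open>\<alpha>\<inverse>\<close> and back by \<open>\<alpha>\<close>.\<close>

lemma cobounds_T0_iff: "(\<exists>l. cobounds K H l T\<^sub>0) \<longleftrightarrow> (\<exists>l. cobounds K H l T)"
proof
  assume "\<exists>l. cobounds K H l T"
  then obtain l where "cobounds K H l (s, s', \<Gamma>')"
    by (auto simp: T_eq)
  then show "\<exists>l. cobounds K H l T\<^sub>0"
    unfolding T0_eq using twisted.cobounds_map[OF _ alpha'_hom alpha'_Gamma'] by blast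
next
  assume "\<exists>l. cobounds K H l T\<^sub>0"
  then obtain l where "cobounds K H l (\<lambda>p \<in> KK. \<alpha>' (s p), \<lambda>p \<in> KK. \<alpha>' (s' p), \<Gamma>)"
    by (auto simp: T0_eq)
  then have "cobounds K H (\<alpha> \<circ> l) (\<lambda>p \<in> KK. \<alpha> ((\<lambda>p \<in> KK. \<alpha>' (s p)) p),
      \<lambda>p \<in> KK. \<alpha> ((\<lambda>p \<in> KK. \<alpha>' (s' p)) p), \<Gamma>')"
    by (rule cobounds_map) (simp_all add: \<alpha>.homh Gamma'_eq compatible)
  moreover have "(\<lambda>p \<in> KK. \<alpha> ((\<lambda>p \<in> KK. \<alpha>' (s p)) p)) = s"
    "(\<lambda>p \<in> KK. \<alpha> ((\<lambda>p \<in> KK. \<alpha>' (s' p)) p)) = s'"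
    using ml_cocycle_f[OF T_cocycle] ml_cocycle_h[OF T_cocycle] s_mem
    by (simp_all add: restrict_eq_PiE)
  ultimately show "\<exists>l. cobounds K H l T"
    by (auto simp: T_eq)
qed

lemma T_class_eq_one_iff:
  "(\<alpha>, \<eta>) \<in> Pi_map ` carrier A \<longleftrightarrow> H2_class K H \<Gamma>' T = \<one>\<^bsub>H2_ML K H \<Gamma>'\<^esub>"
  by (simp add: Pi_image_iff[OF pair] twisted.H2_class_eq_one_iff[OF T_in_Z2] cobounds_T_iff)

lemma chi_eq: "wells_chi H G K i t (\<alpha>, \<eta>) = H2_class K H \<Gamma> T\<^sub>0"
  by (simp add: wells_chi_def Let_def)

lemma chi_eq_one_iff:
  "(\<alpha>, \<eta>) \<in> Pi_map ` carrier A \<longleftrightarrow> wells_chi H G K i t (\<alpha>, \<eta>) = \<one>\<^bsub>H2_ML K H \<Gamma>\<^esub>"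
  by (simp add: Pi_image_iff[OF pair] chi_eq H2_class_eq_one_iff[OF T0_in_Z2]
      cobounds_T0_iff cobounds_T_iff)

lemma chi_closed: "wells_chi H G K i t (\<alpha>, \<eta>) \<in> carrier (H2_ML K H \<Gamma>)"
  unfolding chi_eq by (rule H2_class_closed[OF T0_in_Z2])

end

section \<open>Independence of the transversal\<close>

locale transversal_change = compatible_pair H G K i \<beta> t \<alpha> \<eta>
  for H :: "('h, 'l) mult_lie_scheme"
    and G :: "('g, 'm) mult_lie_scheme"
    and K :: "('k, 'n) mult_lie_scheme"
    and i :: "'h \<Rightarrow> 'g" and \<beta> :: "'g \<Rightarrow> 'k" and t :: "'k \<Rightarrow> 'g"
    and \<alpha> :: "'h \<Rightarrow> 'h" and \<eta> :: "'k \<Rightarrow> 'k" +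
  fixes u :: "'k \<Rightarrow> 'g"
  assumes u: "transversal G K \<beta> u"
begin

sublocale U: center_extension_transversal H G K i \<beta> u
  by unfold_locales (rule u)

lemma Gamma_eq: "U.\<Gamma> = \<Gamma>"
proof -
  have "U.\<Gamma> x a = \<Gamma> x a" if "x \<in> carrier K" "a \<in> carrier H" for x a
  proof -
    have "i (U.\<Gamma> x a) = i (\<Gamma> x a)"
      using that star_i[of "u x" a] U.i_Gamma_t by simp
    then show ?thesis
      using that by (subst (asm) i_eq_iff) (auto intro: U.Gamma_closed)
  qed
  then show ?thesis
    by (auto simp: ext_Gamma_def fun_eq_iff restrict_def)
qed

sublocale U: compatible_pair H G K i \<beta> u \<alpha> \<eta>
  by unfold_locales (simp add: pair Gamma_eq)

definition l :: "'k \<Rightarrow> 'h" where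
  "l x = H_part (u x)"

lemma l_closed [simp]: "x \<in> carrier K \<Longrightarrow> l x \<in> carrier H"
  by (simp add: l_def)

lemma u_eq_nf: "x \<in> carrier K \<Longrightarrow> u x = nf (l x) x"
  using nf_H_part[of "u x"] by (simp add: l_def)

lemma l_one: "l \<one>\<^bsub>K\<^esub> = \<one>\<^bsub>H\<^esub>"
  using u_eq_nf[of "\<one>\<^bsub>K\<^esub>"] by (simp add: one_eq_nf nf_eq_iff)

lemma U_f:
  assumes [simp]: "x \<in> carrier K" "y \<in> carrier K"
  shows "U.f (x, y) = l x \<otimes>\<^bsub>H\<^esub> l y \<otimes>\<^bsub>H\<^esub> inv\<^bsub>H\<^esub> (l (x \<otimes>\<^bsub>K\<^esub> y)) \<otimes>\<^bsub>H\<^esub> f (x, y)"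
proof -
  have "nf (l x \<otimes>\<^bsub>H\<^esub> l y \<otimes>\<^bsub>H\<^esub> f (x, y)) (x \<otimes>\<^bsub>K\<^esub> y) = nf (U.f (x, y) \<otimes>\<^bsub>H\<^esub> l (x \<otimes>\<^bsub>K\<^esub> y)) (x \<otimes>\<^bsub>K\<^esub> y)"
    using U.t_mult[of x y] by (simp add: U.nf_def u_eq_nf nf_mult i_mult_nf)
  then have "l x \<otimes>\<^bsub>H\<^esub> l y \<otimes>\<^bsub>H\<^esub> f (x, y) = U.f (x, y) \<otimes>\<^bsub>H\<^esub> l (x \<otimes>\<^bsub>K\<^esub> y)"
    by (simp add: nf_eq_iff)
  then have "U.f (x, y) = l x \<otimes>\<^bsub>H\<^esub> l y \<otimes>\<^bsub>H\<^esub> f (x, y) \<otimes>\<^bsub>H\<^esub> inv\<^bsub>H\<^esub> (l (x \<otimes>\<^bsub>K\<^esub> y))"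
    by (simp add: H.inv_solve_right)
  then show ?thesis
    by (simp add: H.m_ac)
qed

lemma U_h:
  assumes [simp]: "x \<in> carrier K" "y \<in> carrier K"
  shows "U.h (x, y) = \<Gamma> x (l y) \<otimes>\<^bsub>H\<^esub> \<Gamma> y (inv\<^bsub>H\<^esub> (l x)) \<otimes>\<^bsub>H\<^esub> inv\<^bsub>H\<^esub> (l (x \<star>\<^bsub>K\<^esub> y)) \<otimes>\<^bsub>H\<^esub> h (x, y)"
proof -
  have "nf (\<Gamma> x (l y) \<otimes>\<^bsub>H\<^esub> \<Gamma> y (inv\<^bsub>H\<^esub> (l x)) \<otimes>\<^bsub>H\<^esub> h (x, y)) (x \<star>\<^bsub>K\<^esub> y)
      = nf (U.h (x, y) \<otimes>\<^bsub>H\<^esub> l (x \<star>\<^bsub>K\<^esub> y)) (x \<star>\<^bsub>K\<^esub> y)"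
    using U.t_star[of x y] by (simp add: U.nf_def u_eq_nf nf_star i_mult_nf)
  then have "\<Gamma> x (l y) \<otimes>\<^bsub>H\<^esub> \<Gamma> y (inv\<^bsub>H\<^esub> (l x)) \<otimes>\<^bsub>H\<^esub> h (x, y) = U.h (x, y) \<otimes>\<^bsub>H\<^esub> l (x \<star>\<^bsub>K\<^esub> y)"
    by (simp add: nf_eq_iff)
  then have "U.h (x, y) = \<Gamma> x (l y) \<otimes>\<^bsub>H\<^esub> \<Gamma> y (inv\<^bsub>H\<^esub> (l x)) \<otimes>\<^bsub>H\<^esub> h (x, y) \<otimes>\<^bsub>H\<^esub> inv\<^bsub>H\<^esub> (l (x \<star>\<^bsub>K\<^esub> y))"
    by (simp add: H.inv_solve_right)
  then show ?thesis
    by (simp add: H.m_ac)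
qed

text \<open>If \<open>(f, h)\<close> is multiplied by the coboundary of \<open>l\<close>, then its reindexing along \<open>\<eta>\<close> is multiplied
  by the coboundary of \<open>l \<circ> \<eta>\<close> and its image under \<open>\<alpha>\<close> by that of \<open>\<alpha> \<circ> l\<close>.\<close>

lemma cobounds_difference:
  "cobounds K H (\<lambda>x. l (\<eta> x) \<otimes>\<^bsub>H\<^esub> inv\<^bsub>H\<^esub> (\<alpha> (l x)))
    (\<lambda>p \<in> KK. U.s p \<otimes>\<^bsub>H\<^esub> inv\<^bsub>H\<^esub> (s p), \<lambda>p \<in> KK. U.s' p \<otimes>\<^bsub>H\<^esub> inv\<^bsub>H\<^esub> (s' p), \<Gamma>')"
proof -
  have cancel: "b \<otimes>\<^bsub>H\<^esub> c \<otimes>\<^bsub>H\<^esub> inv\<^bsub>H\<^esub> (a \<otimes>\<^bsub>H\<^esub> d) \<otimes>\<^bsub>H\<^esub> inv\<^bsub>H\<^esub> (c \<otimes>\<^bsub>H\<^esub> inv\<^bsub>H\<^esub> d) = b \<otimes>\<^bsub>H\<^esub> inv\<^bsub>H\<^esub> a"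
    if [simp]: "a \<in> carrier H" "b \<in> carrier H" "c \<in> carrier H" "d \<in> carrier H" for a b c d
  proof -
    have "b \<otimes>\<^bsub>H\<^esub> c \<otimes>\<^bsub>H\<^esub> inv\<^bsub>H\<^esub> (a \<otimes>\<^bsub>H\<^esub> d) \<otimes>\<^bsub>H\<^esub> inv\<^bsub>H\<^esub> (c \<otimes>\<^bsub>H\<^esub> inv\<^bsub>H\<^esub> d)
        = b \<otimes>\<^bsub>H\<^esub> inv\<^bsub>H\<^esub> a \<otimes>\<^bsub>H\<^esub> ((c \<otimes>\<^bsub>H\<^esub> inv\<^bsub>H\<^esub> c) \<otimes>\<^bsub>H\<^esub> (d \<otimes>\<^bsub>H\<^esub> inv\<^bsub>H\<^esub> d))"
      unfolding H.inv_mult[OF that(1,4)] H.inv_mult[OF that(3) H.inv_closed[OF that(4)]]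
      by (simp only: H.m_ac that H.inv_closed H.m_closed H.inv_inv)
    then show ?thesis by simp
  qed
  note [simp] = mla_hom_star[OF K.mult_lie_algebra_axioms K.mult_lie_algebra_axioms eta_hom]
  show ?thesis
    unfolding cobounds_def prod.case
  proof (intro conjI ballI)
    fix x y assume [simp]: "x \<in> carrier K" "y \<in> carrier K"
    show "(\<lambda>p \<in> KK. U.s p \<otimes>\<^bsub>H\<^esub> inv\<^bsub>H\<^esub> (s p)) (x, y) =
        l (\<eta> x) \<otimes>\<^bsub>H\<^esub> inv\<^bsub>H\<^esub> (\<alpha> (l x)) \<otimes>\<^bsub>H\<^esub> (l (\<eta> y) \<otimes>\<^bsub>H\<^esub> inv\<^bsub>H\<^esub> (\<alpha> (l y)))
        \<otimes>\<^bsub>H\<^esub> inv\<^bsub>H\<^esub> (l (\<eta> (x \<otimes>\<^bsub>K\<^esub> y)) \<otimes>\<^bsub>H\<^esub> inv\<^bsub>H\<^esub> (\<alpha> (l (x \<otimes>\<^bsub>K\<^esub> y))))"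
      by (simp add: U_f cancel) (simp add: H.inv_mult H.m_ac)
    show "(\<lambda>p \<in> KK. U.s' p \<otimes>\<^bsub>H\<^esub> inv\<^bsub>H\<^esub> (s' p)) (x, y) =
        \<Gamma>' x (l (\<eta> y) \<otimes>\<^bsub>H\<^esub> inv\<^bsub>H\<^esub> (\<alpha> (l y))) \<otimes>\<^bsub>H\<^esub> \<Gamma>' y (inv\<^bsub>H\<^esub> (l (\<eta> x) \<otimes>\<^bsub>H\<^esub> inv\<^bsub>H\<^esub> (\<alpha> (l x))))
        \<otimes>\<^bsub>H\<^esub> inv\<^bsub>H\<^esub> (l (\<eta> (x \<star>\<^bsub>K\<^esub> y)) \<otimes>\<^bsub>H\<^esub> inv\<^bsub>H\<^esub> (\<alpha> (l (x \<star>\<^bsub>K\<^esub> y))))"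
      by (simp add: U_h cancel)
        (simp add: Gamma'_eq compatible Gamma_mult Gamma_inv H.inv_mult H.m_ac)
  qed (simp_all add: l_one)
qed

lemma chi_transversal_independent: "wells_chi H G K i u (\<alpha>, \<eta>) = wells_chi H G K i t (\<alpha>, \<eta>)"
proof -
  have "cobounds K H (\<alpha>' \<circ> (\<lambda>x. l (\<eta> x) \<otimes>\<^bsub>H\<^esub> inv\<^bsub>H\<^esub> (\<alpha> (l x))))
    (\<lambda>p \<in> KK. \<alpha>' ((\<lambda>p \<in> KK. U.s p \<otimes>\<^bsub>H\<^esub> inv\<^bsub>H\<^esub> (s p)) p),
     \<lambda>p \<in> KK. \<alpha>' ((\<lambda>p \<in> KK. U.s' p \<otimes>\<^bsub>H\<^esub> inv\<^bsub>H\<^esub> (s' p)) p), \<Gamma>)"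
    by (rule twisted.cobounds_map[OF cobounds_difference alpha'_hom alpha'_Gamma'])
  moreover interpret \<alpha>': group_hom H H \<alpha>'
    using alpha'_hom by unfold_locales
  have "\<alpha>' (a \<otimes>\<^bsub>H\<^esub> inv\<^bsub>H\<^esub> b) = \<alpha>' a \<otimes>\<^bsub>H\<^esub> inv\<^bsub>H\<^esub> (\<alpha>' b)" if "a \<in> carrier H" "b \<in> carrier H" for a b
    using that \<alpha>'.hom_mult[of a "inv\<^bsub>H\<^esub> b"] \<alpha>'.hom_inv[of b] by simp
  then have "(\<lambda>p \<in> KK. \<alpha>' ((\<lambda>p \<in> KK. U.s p \<otimes>\<^bsub>H\<^esub> inv\<^bsub>H\<^esub> (s p)) p)) =
      (\<lambda>p \<in> KK. (\<lambda>p \<in> KK. \<alpha>' (U.s p)) p \<otimes>\<^bsub>H\<^esub> inv\<^bsub>H\<^esub> ((\<lambda>p \<in> KK. \<alpha>' (s p)) p))"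
    "(\<lambda>p \<in> KK. \<alpha>' ((\<lambda>p \<in> KK. U.s' p \<otimes>\<^bsub>H\<^esub> inv\<^bsub>H\<^esub> (s' p)) p)) =
      (\<lambda>p \<in> KK. (\<lambda>p \<in> KK. \<alpha>' (U.s' p)) p \<otimes>\<^bsub>H\<^esub> inv\<^bsub>H\<^esub> ((\<lambda>p \<in> KK. \<alpha>' (s' p)) p))"
    using s_mem U.s_mem by (simp_all cong: restrict_cong)
  ultimately show ?thesis
    unfolding chi_eq U.chi_eq T0_eq Gamma_eq U.T0_eq[unfolded Gamma_eq]
    using T0_cocycle U.T0_cocycle[unfolded Gamma_eq] by (intro H2_class_eqI) auto
qed

end

section \<open>The exact sequence\<close>

theorem theorem3p7:
  fixes H :: "('h, 'l) mult_lie_scheme"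
    and G :: "('g, 'm) mult_lie_scheme"
    and K :: "('k, 'n) mult_lie_scheme"
    and i :: "'h \<Rightarrow> 'g" and \<beta> :: "'g \<Rightarrow> 'k" and t :: "'k \<Rightarrow> 'g"
  assumes "center_extension H G K i \<beta>"
    and "transversal G K \<beta> t"
  shows
    "let \<Gamma> = ext_Gamma H G K i t;
         f = ext_f H G K i t;
         h = ext_h H G K i t;
         Z1 = Z1_ML K H \<Gamma>;
         A = Aut_sub H G i;
         C = compatible_pairs H K \<Gamma>;
         \<iota> = wells_iota H G K i \<beta> t;
         \<pi> = wells_Pi H K i \<beta> t;
         \<chi> = wells_chi H G K i t
     in comm_group Z1 \<and> comm_group (Z2_ML K H \<Gamma>) \<and>
        subgroup (B2_ML K H \<Gamma>) (Z2_ML K H \<Gamma>) \<and>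
        group_hom Z1 A \<iota> \<and> inj_on \<iota> (carrier Z1) \<and>
        group_hom A C \<pi> \<and> \<iota> ` carrier Z1 = kernel A C \<pi> \<and>
        \<chi> \<in> carrier C \<rightarrow> carrier (H2_ML K H \<Gamma>) \<and>
        \<pi> ` carrier A = {p \<in> carrier C. \<chi> p = \<one>\<^bsub>H2_ML K H \<Gamma>\<^esub>} \<and>
        (\<forall>t'. transversal G K \<beta> t' \<longrightarrow>
           ext_Gamma H G K i t' = \<Gamma> \<and>
           (\<forall>p \<in> carrier C. wells_chi H G K i t' p = \<chi> p)) \<and>
        (\<forall>p \<in> carrier C.
           let \<Gamma>' = twist K \<Gamma> (snd p); T = wells_triple H K \<Gamma> f h p
           in coeff_pullback H K (fst p) T \<in> carrier (Z2_ML K H \<Gamma>) \<and>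
              T \<in> carrier (Z2_ML K H \<Gamma>') \<and>
              (p \<in> \<pi> ` carrier A \<longleftrightarrow> H2_class K H \<Gamma>' T = \<one>\<^bsub>H2_ML K H \<Gamma>'\<^esub>))"
proof -
  interpret E: center_extension_transversal H G K i \<beta> t
    using assms by (intro center_extension_transversal.intro center_extension_transversal_axioms.intro)
  have pair: "compatible_pair H G K i \<beta> t \<alpha> \<eta>" if "(\<alpha>, \<eta>) \<in> carrier E.C" for \<alpha> \<eta>
    using that by (intro compatible_pair.intro compatible_pair_axioms.intro)
      (rule E.center_extension_transversal_axioms)
  note change = transversal_change.intro[OF pair transversal_change_axioms.intro]
  have Gamma: "ext_Gamma H G K i u = E.\<Gamma>" if "transversal G K \<beta> u" for u
    using transversal_change.Gamma_eq[OF change[OF E.id_in_C that]] .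
  have chi_iff: "p \<in> E.Pi_map ` carrier E.A \<longleftrightarrow> wells_chi H G K i t p = \<one>\<^bsub>H2_ML K H E.\<Gamma>\<^esub>"
    if "p \<in> carrier E.C" for p
    using compatible_pair.chi_eq_one_iff[OF pair, of "fst p" "snd p"] that
    by (simp only: prod.collapse)
  have im: "E.Pi_map ` carrier E.A \<subseteq> carrier E.C"
    using group_hom.hom_closed[OF E.Pi_group_hom] by blast
  show ?thesis
    unfolding Let_def
  proof (intro conjI ballI allI impI)
    show "comm_group (Z1_ML K H E.\<Gamma>)" by (rule E.Z1_ML_comm_group)
    show "comm_group (Z2_ML K H E.\<Gamma>)" by (rule E.Z2_ML_comm_group)
    show "subgroup (B2_ML K H E.\<Gamma>) (Z2_ML K H E.\<Gamma>)" by (rule E.B2_ML_subgroup)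
    show "group_hom (Z1_ML K H E.\<Gamma>) E.A E.iota" by (rule E.iota_group_hom)
    show "inj_on E.iota (carrier (Z1_ML K H E.\<Gamma>))" by (rule E.iota_inj)
    show "group_hom E.A E.C E.Pi_map" by (rule E.Pi_group_hom)
    show "E.iota ` carrier (Z1_ML K H E.\<Gamma>) = kernel E.A E.C E.Pi_map" by (rule E.iota_image)
    show "wells_chi H G K i t \<in> carrier E.C \<rightarrow> carrier (H2_ML K H E.\<Gamma>)"
      using compatible_pair.chi_closed[OF pair] by auto
    show "E.Pi_map ` carrier E.A = {p \<in> carrier E.C. wells_chi H G K i t p = \<one>\<^bsub>H2_ML K H E.\<Gamma>\<^esub>}"
      using im chi_iff by blast
  next
    fix u assume u: "transversal G K \<beta> u"
    show "ext_Gamma H G K i u = E.\<Gamma>" by (rule Gamma[OF u])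
    fix p assume "p \<in> carrier E.C"
    then show "wells_chi H G K i u p = wells_chi H G K i t p"
      using transversal_change.chi_transversal_independent[OF change[OF _ u]] by (cases p) simp
  next
    fix p assume p: "p \<in> carrier E.C"
    obtain \<alpha> \<eta> where eq: "p = (\<alpha>, \<eta>)" by force
    interpret P: compatible_pair H G K i \<beta> t \<alpha> \<eta>
      using p unfolding eq by (rule pair)
    show "coeff_pullback H K (fst p) (wells_triple H K E.\<Gamma> E.f E.h p) \<in> carrier (Z2_ML K H E.\<Gamma>)"
      using P.T0_in_Z2 by (simp add: eq)
    show "wells_triple H K E.\<Gamma> E.f E.h p \<in> carrier (Z2_ML K H (twist K E.\<Gamma> (snd p)))"
      using P.T_in_Z2 by (simp add: eq)
    show "p \<in> E.Pi_map ` carrier E.A \<longleftrightarrow> H2_class K H (twist K E.\<Gamma> (snd p)) (wells_triple H K E.\<Gamma> E.f E.h p)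
        = \<one>\<^bsub>H2_ML K H (twist K E.\<Gamma> (snd p))\<^esub>"
      using P.T_class_eq_one_iff by (simp only: eq snd_conv)
  qed
qed

end
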